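(* Let $Q$ be a prime power, let $\alpha\in\mathbb{F}_{Q^3}^*$ and let $\beta\in\mathbb{F}_Q$. The polynomial $f(x):=\alpha x^{Q^2+Q+2}+\beta x$ is a complete permutation polynomial over $\mathbb{F}_{Q^3}$ if and only if one of the following holds: (1) $Q$ is even and $\alpha^{Q^2}+\alpha^{Q^2-Q+1}+\alpha=0$; (2) $Q=7$ and $2\alpha^{24}+4\alpha^{12}+\alpha^6+1=0$ and $\beta\notin\{0,-1\}$; (3) $Q=3$ and $\alpha^{12}+\alpha^{8}+\alpha^2+1=0$ and $\beta=1$; or (4) $Q=2$ and $\alpha\ne 1$.
   Context: For a prime power $Q$, $\mathbb{F}_Q$ denotes the finite field with $Q$ elements, regarded as a subfield of $\mathbb{F}_{Q^3}$, and $\mathbb{F}_{Q^3}^*$ is the set of nonzero elements of $\mathbb{F}_{Q^3}$. A polynomial is a permutation polynomial over a finite field $\mathbb{F}$ if it induces a bijection from $\mathbb{F}$ to itself. A complete permutation polynomial over $\mathbb{F}_q$ is a polynomial $f(x)\in\mathbb{F}_q[x]$ such that both $f(x)$ and $f(x)+x$ are permutation polynomials over $\mathbb{F}_q$. *)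

theory Defs
  imports
    "HOL-Library.Cardinality"
    "HOL-Computational_Algebra.Polynomial"
    "HOL-Number_Theory.Prime_Powers"
begin

definition is_subfield :: "'a::field set \<Rightarrow> bool" where
  "is_subfield K \<longleftrightarrow>
     0 \<in> K \<and> 1 \<in> K \<and>
     (\<forall>x\<in>K. \<forall>y\<in>K. x + y \<in> K \<and> x * y \<in> K) \<and>
     (\<forall>x\<in>K. - x \<in> K \<and> inverse x \<in> K)"

definition permutation_polynomial :: "'a::{field,finite} poly \<Rightarrow> bool" where
  "permutation_polynomial f \<longleftrightarrow> bij (poly f)"

definition complete_permutation_polynomial :: "'a::{field,finite} poly \<Rightarrow> bool" where
  "complete_permutation_polynomial f \<longleftrightarrow>
     permutation_polynomial f \<and> permutation_polynomial (f + [:0, 1:])"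

end

theory Submission
  imports Defs "HOL-Number_Theory.Cong"
begin

text \<open>
  Since \<open>\<alpha> x\<^bsup>Q\<^sup>2+Q+2\<^esup> + \<beta> x = x (\<alpha> N(x) + \<beta>)\<close> with \<open>N\<close> the norm to \<open>GF(Q)\<close>, taking norms shows that
  this polynomial permutes the cubic extension iff \<open>t \<mapsto> t N(\<alpha> t + \<beta>)\<close> permutes \<open>GF(Q)\<close>. For \<open>\<beta> \<noteq> 0\<close> the
  substitution \<open>t = \<beta> s\<close> removes \<open>\<beta>\<close> and leaves the quartic \<open>N(\<alpha>) s\<^sup>4 + T\<^sub>2 s\<^sup>3 + T\<^sub>1 s\<^sup>2 + s\<close>, where
  \<open>T\<^sub>1\<close> and \<open>T\<^sub>2\<close> are the other elementary symmetric functions of the conjugates of \<open>\<alpha>\<close>; for \<open>\<beta> = 0\<close> it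
  leaves \<open>N(\<alpha>) t\<^sup>4\<close>, which permutes \<open>GF(Q)\<close> iff \<open>Q\<close> is even.

  It remains to decide when the quartic is a permutation. For odd \<open>Q\<close>, Hermite's criterion with
  exponents near \<open>Q/4\<close> leaves only \<open>Q = 3\<close> and, up to an affine change of variable, \<open>x\<^sup>4 + b x\<close> with
  \<open>b\<^sup>2 = 2\<close> over \<open>GF(7)\<close>. For even \<open>Q > 2\<close> an Artin--Schreier argument forces \<open>T\<^sub>2 = 0\<close>, and then the
  quartic is additive with trivial kernel.
\<close>

section \<open>Power sums over a finite subfield\<close>

lemma card_roots_le_degree:
  fixes p :: "'a::idom poly"
  assumes "p \<noteq> 0" "\<And>x. x \<in> A \<Longrightarrow> poly p x = 0"
  shows "finite A" "card A \<le> degree p"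
proof -
  have sub: "A \<subseteq> {x. poly p x = 0}" using assms(2) by auto
  have fin: "finite {x. poly p x = 0}" using assms(1) by (rule poly_roots_finite)
  show "finite A" using sub fin by (rule finite_subset)
  show "card A \<le> degree p"
    using card_mono[OF fin sub] card_poly_roots_bound[OF assms(1)] by linarith
qed

locale finite_subfield =
  fixes K :: "'a::field set"
  assumes subfield: "is_subfield K" and finite_K: "finite K"
begin

abbreviation q :: nat where "q \<equiv> card K"

section \<open>Arithmetic of a finite subfield\<close>

lemma closed [simp]:
  "0 \<in> K" "1 \<in> K"
  "x \<in> K \<Longrightarrow> y \<in> K \<Longrightarrow> x + y \<in> K"
  "x \<in> K \<Longrightarrow> y \<in> K \<Longrightarrow> x * y \<in> K"
  "x \<in> K \<Longrightarrow> - x \<in> K"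
  "x \<in> K \<Longrightarrow> inverse x \<in> K"
  using subfield by (auto simp: is_subfield_def)

lemma closed_diff [simp]: "x \<in> K \<Longrightarrow> y \<in> K \<Longrightarrow> x - y \<in> K"
  using closed(3)[of x "- y"] by simp

lemma closed_divide [simp]: "x \<in> K \<Longrightarrow> y \<in> K \<Longrightarrow> x / y \<in> K"
  by (simp add: divide_inverse)

lemma closed_power [simp]: "x \<in> K \<Longrightarrow> x ^ n \<in> K"
  by (induction n) auto

lemma closed_of_nat [simp]: "of_nat n \<in> K"
  by (induction n) auto

lemma closed_numeral [simp]: "numeral n \<in> K"
  using closed_of_nat[of "numeral n"] by simp

lemma q_ge_2: "q \<ge> 2"
proof -
  have "card {0, 1::'a} \<le> q"
    by (rule card_mono[OF finite_K]) auto
  thus ?thesis by simp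
qed

lemma card_units: "card (K - {0}) = q - 1"
  by (simp add: finite_K)

text \<open>Translation by 1 permutes \<open>K\<close>, so it preserves the sum of all elements
  while adding \<open>q\<close> ones to it.\<close>

lemma of_nat_q: "of_nat q = (0::'a)"
proof -
  have "(\<Sum>x\<in>K. x) = (\<Sum>x\<in>K. x + 1)"
    by (rule sum.reindex_bij_witness[of _ "\<lambda>x. x + 1" "\<lambda>x. x - 1"]) auto
  thus ?thesis by (simp add: sum.distrib)
qed

text \<open>Multiplication by \<open>x\<close> permutes the units, so it preserves their nonzero
  product while contributing the factor \<open>x ^ (q - 1)\<close>.\<close>

lemma power_q_minus_1:
  assumes "x \<in> K" "x \<noteq> 0"
  shows "x ^ (q - 1) = 1"
proof -
  have "(\<Prod>y\<in>K-{0}. y) = (\<Prod>y\<in>K-{0}. x * y)"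
    by (rule prod.reindex_bij_witness[of _ "\<lambda>y. x * y" "\<lambda>y. y / x"]) (use assms in auto)
  also have "\<dots> = x ^ (q - 1) * (\<Prod>y\<in>K-{0}. y)"
    by (simp add: prod.distrib card_units)
  finally show ?thesis
    using finite_K by (simp add: prod_zero_iff)
qed

lemma power_q: "x \<in> K \<Longrightarrow> x ^ q = x"
  using power_q_minus_1[of x] q_ge_2
  by (cases "x = 0") (auto simp: power_eq_if)

lemma power_unit_cong:
  assumes "x \<in> K" "x \<noteq> 0" "[m = n] (mod (q - 1))"
  shows "x ^ m = x ^ n"
proof -
  have "x ^ k = x ^ (k mod (q - 1))" for k
  proof -
    have "x ^ k = x ^ ((q - 1) * (k div (q - 1)) + k mod (q - 1))" by simp
    thus ?thesis unfolding power_add power_mult power_q_minus_1[OF assms(1,2)] by simp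
  qed
  from this[of m] this[of n] assms(3) show ?thesis by (simp add: cong_def)
qed

text \<open>\<open>X^q - X\<close> has at most \<open>q\<close> roots, and \<open>K\<close> already
  supplies that many. Norms and traces are later placed in \<open>K\<close> by their Frobenius
  invariance.\<close>

lemma mem_iff_power_q: "x \<in> K \<longleftrightarrow> x ^ q = x"
proof
  assume x: "x ^ q = x"
  let ?p = "monom 1 q - monom 1 1 :: 'a poly"
  have deg: "degree ?p \<le> q"
    using q_ge_2 by (intro degree_diff_le) (auto intro: order_trans[OF degree_monom_le])
  have "coeff ?p q = 1" using q_ge_2 by simp
  hence nz: "?p \<noteq> 0" by (metis coeff_0 zero_neq_one)
  have roots: "poly ?p y = 0" if "y \<in> insert x K" for y
    using that x power_q by (auto simp: poly_monom)
  have "card (insert x K) \<le> q"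
    using card_roots_le_degree(2)[OF nz, of "insert x K"] roots deg by fastforce
  thus "x \<in> K"
    using finite_K by (auto simp: card_insert_if split: if_splits)
qed (rule power_q)

text \<open>If \<open>q - 1\<close> does not divide \<open>n\<close>, counting roots of
  \<open>X^r - 1\<close> yields a unit \<open>x\<close> with \<open>x ^ n\<close> different from 1.
  Replacing \<open>u\<close> by \<open>x * u\<close> multiplies the sum by that factor, so it
  vanishes.\<close>

lemma sum_units_power:
  "(\<Sum>u\<in>K-{0}. u ^ n) = (if (q - 1) dvd n then - 1 else (0::'a))"
proof (cases "(q - 1) dvd n")
  case True
  have "(\<Sum>u\<in>K-{0}. u ^ n) = (\<Sum>u\<in>K-{0}. 1::'a)"
    by (rule sum.cong) (use True power_unit_cong[of _ n 0] in \<open>auto simp: cong_0_iff\<close>)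
  also have "\<dots> = of_nat (q - 1)" by (simp add: card_units)
  also have "\<dots> = - 1" using of_nat_q q_ge_2 by (simp add: of_nat_diff)
  finally show ?thesis using True by simp
next
  case False
  define r where "r = n mod (q - 1)"
  have r: "r > 0" "r < q - 1"
    using False q_ge_2 by (auto simp: r_def dvd_eq_mod_eq_0)
  have "\<exists>x\<in>K-{0}. x ^ r \<noteq> 1"
  proof (rule ccontr)
    assume *: "\<not> (\<exists>x\<in>K-{0}. x ^ r \<noteq> 1)"
    let ?p = "monom 1 r - 1 :: 'a poly"
    have "coeff ?p r = 1" using r by simp
    hence nz: "?p \<noteq> 0" by (metis coeff_0 zero_neq_one)
    have "card (K - {0}) \<le> degree ?p"
      by (rule card_roots_le_degree(2)[OF nz]) (use * in \<open>auto simp: poly_monom\<close>)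
    also have "\<dots> \<le> r"
      by (intro degree_diff_le) (auto intro: degree_monom_le)
    finally show False using r card_units by simp
  qed
  then obtain x where x: "x \<in> K" "x \<noteq> 0" "x ^ r \<noteq> 1" by auto
  have "x ^ n = x ^ r"
    by (rule power_unit_cong[OF x(1,2)]) (simp add: r_def cong_def)
  hence xn: "x ^ n \<noteq> 1" using x by simp
  have "(\<Sum>u\<in>K-{0}. u ^ n) = (\<Sum>u\<in>K-{0}. (x * u) ^ n)"
    by (rule sum.reindex_bij_witness[of _ "\<lambda>y. x * y" "\<lambda>y. y / x"]) (use x in auto)
  also have "\<dots> = x ^ n * (\<Sum>u\<in>K-{0}. u ^ n)"
    by (simp add: power_mult_distrib sum_distrib_left)
  finally have "(1 - x ^ n) * (\<Sum>u\<in>K-{0}. u ^ n) = 0" by (simp add: algebra_simps)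
  thus ?thesis using xn False by simp
qed

lemma sum_units_power_poly:
  assumes "degree p \<le> D"
  shows "(\<Sum>u\<in>K-{0}. u ^ m * poly p u)
           = - (\<Sum>i\<le>D. if (q - 1) dvd (m + i) then coeff p i else 0)"
proof -
  have P: "poly p u = (\<Sum>i\<le>D. coeff p i * u ^ i)" for u
    unfolding poly_altdef
    by (rule sum.mono_neutral_left) (use assms in \<open>auto simp: coeff_eq_0\<close>)
  have "(\<Sum>u\<in>K-{0}. u ^ m * poly p u) = (\<Sum>u\<in>K-{0}. \<Sum>i\<le>D. coeff p i * u ^ (m + i))"
    by (simp add: P sum_distrib_left power_add mult_ac)
  also have "\<dots> = (\<Sum>i\<le>D. coeff p i * (\<Sum>u\<in>K-{0}. u ^ (m + i)))"
    by (subst sum.swap) (simp add: sum_distrib_left)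
  also have "\<dots> = (\<Sum>i\<le>D. - (if (q - 1) dvd (m + i) then coeff p i else 0))"
    by (rule sum.cong) (auto simp: sum_units_power)
  finally show ?thesis by (simp add: sum_negf)
qed

text \<open>The necessary half of Hermite's criterion: a permutation leaves power sums unchanged,
  and these vanish for exponents strictly between 0 and \<open>q - 1\<close>.\<close>

lemma sum_power_permutation:
  assumes "inj_on \<phi> K" "\<phi> ` K \<subseteq> K" "k > 0" "k < q - 1"
  shows "(\<Sum>x\<in>K. \<phi> x ^ k) = (0::'a)"
proof -
  have im: "\<phi> ` K = K" by (rule endo_inj_surj[OF finite_K assms(2,1)])
  have "(\<Sum>x\<in>K. \<phi> x ^ k) = (\<Sum>x\<in>\<phi> ` K. x ^ k)"
    by (simp add: sum.reindex[OF assms(1)])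
  also have "\<dots> = (\<Sum>x\<in>K-{0}. x ^ k)"
    unfolding im by (rule sum.mono_neutral_right) (use finite_K assms(3) in auto)
  finally show ?thesis
    using assms(3,4) by (auto simp: sum_units_power dest: dvd_imp_le)
qed

(* Writing y = 1/x turns x^4 + c x^3 + a x^2 + b x into (1 + c y + a y^2 + b y^3) / y^4. *)
lemma quartic_hermite:
  fixes a b c :: 'a
  assumes inj: "inj_on (\<lambda>x. x ^ 4 + c * x ^ 3 + a * x ^ 2 + b * x) K"
    and abc: "a \<in> K" "b \<in> K" "c \<in> K"
    and k: "k > 0" "k < q - 1"
    and m: "(q - 1) dvd (m + 4 * k)"
  shows "(\<Sum>i\<le>3 * k. if (q - 1) dvd (m + i) then coeff ([:1, c, a, b:] ^ k) i else 0) = 0"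
proof -
  let ?\<phi> = "\<lambda>x. x ^ 4 + c * x ^ 3 + a * x ^ 2 + b * x"
  have eq: "u ^ m * poly ([:1, c, a, b:] ^ k) u = ?\<phi> (inverse u) ^ k" if u: "u \<in> K" "u \<noteq> 0" for u
  proof -
    \<comment> \<open>The natural number \<open>m\<close> stands for -4k modulo
      \<open>q - 1\<close>, so \<open>u ^ m\<close> is the k-th power of
      \<open>1 / u ^ 4\<close>.\<close>
    have "u ^ m * u ^ (4 * k) = 1"
      using power_unit_cong[OF u, of "m + 4 * k" 0] m by (simp add: cong_0_iff power_add)
    hence "u ^ m = inverse (u ^ 4) ^ k"
      using u unfolding power_mult by (simp add: divide_simps)
    moreover have "inverse (u ^ 4) * poly [:1, c, a, b:] u = ?\<phi> (inverse u)"
      using u by (simp add: field_simps eval_nat_numeral)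
    ultimately show ?thesis
      by (simp only: poly_power power_mult_distrib[symmetric])
  qed
  have "degree ([:1, c, a, b:] ^ k) \<le> 3 * k"
    by (rule order_trans[OF degree_power_le]) auto
  from sum_units_power_poly[OF this]
  have "- (\<Sum>i\<le>3 * k. if (q - 1) dvd (m + i) then coeff ([:1, c, a, b:] ^ k) i else 0)
          = (\<Sum>u\<in>K-{0}. u ^ m * poly ([:1, c, a, b:] ^ k) u)"
    by (rule sym)
  also have "\<dots> = (\<Sum>u\<in>K-{0}. ?\<phi> (inverse u) ^ k)"
    by (rule sum.cong) (use eq in auto)
  also have "\<dots> = (\<Sum>u\<in>K-{0}. ?\<phi> u ^ k)"
    by (rule sum.reindex_bij_witness[of _ inverse inverse]) auto
  also have "\<dots> = (\<Sum>u\<in>K. ?\<phi> u ^ k)"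
    by (rule sum.mono_neutral_left) (use finite_K k(1) in auto)
  also have "\<dots> = 0"
    by (rule sum_power_permutation[OF inj]) (use abc k in auto)
  finally show ?thesis by simp
qed

end

section \<open>Quartics over finite fields of odd characteristic\<close>

lemma coeff_power_no_linear_term:
  fixes a b :: "'a::comm_ring_1"
  shows "coeff ([:1, 0, a, b:] ^ k) 0 = 1 \<and> coeff ([:1, 0, a, b:] ^ k) 1 = 0
       \<and> coeff ([:1, 0, a, b:] ^ k) 2 = of_nat k * a"
  by (induction k) (auto simp: coeff_mult numeral_2_eq_2 algebra_simps)

text \<open>The second power sum in \<open>inj_quartic_3_mod_4\<close> picks out the indices 0 and
  6; index 3 feeds the recursion for index 6.\<close>

lemma coeff_power_cubic_binomial:
  fixes b :: "'a::comm_ring_1"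
  shows "coeff ([:1, 0, 0, b:] ^ k) 0 = 1 \<and> coeff ([:1, 0, 0, b:] ^ k) 3 = of_nat k * b
       \<and> coeff ([:1, 0, 0, b:] ^ k) 6 = of_nat (k choose 2) * b ^ 2"
proof (induction k)
  case (Suc k)
  let ?p = "[:1, 0, 0, b:]"
  have step: "coeff (?p ^ Suc k) (n + 3) = coeff (?p ^ k) (n + 3) + b * coeff (?p ^ k) n"
    "coeff (?p ^ Suc k) 0 = coeff (?p ^ k) 0" for n
    by (simp_all add: numeral_3_eq_3)
  show ?case
    using Suc step(1)[of 0] step(1)[of 3] step(2)
    by (simp add: numeral_2_eq_2 algebra_simps)
qed (simp add: binomial_eq_0)

context finite_subfield
begin

text \<open>Hermite's criterion with \<open>k = (q - 1) / 4\<close> and \<open>m = 0\<close>: the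
  degree \<open>3 * k\<close> stays below \<open>q - 1\<close>, so only the constant coefficient 1
  survives, and it would have to vanish.\<close>

lemma not_inj_quartic_1_mod_4:
  assumes "q mod 4 = 1" "a \<in> K" "b \<in> K" "c \<in> K"
  shows "\<not> inj_on (\<lambda>x. x ^ 4 + c * x ^ 3 + a * x ^ 2 + b * x) K"
proof
  assume inj: "inj_on (\<lambda>x. x ^ 4 + c * x ^ 3 + a * x ^ 2 + b * x) K"
  define k where "k = q div 4"
  have q: "q = 4 * k + 1" "k > 0"
    using assms(1) q_ge_2 by (auto simp: k_def) presburger+
  let ?p = "[:1, c, a, b:]"
  have "(\<Sum>i\<le>3 * k. if (q - 1) dvd (0 + i) then coeff (?p ^ k) i else 0) = 0"
    by (rule quartic_hermite[OF inj assms(2-4)]) (use q in auto)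
  also have "(\<Sum>i\<le>3 * k. if (q - 1) dvd (0 + i) then coeff (?p ^ k) i else 0)
               = (\<Sum>i\<in>{0}. coeff (?p ^ k) i)"
    by (rule sum.mono_neutral_cong_right) (use q in \<open>auto dest: dvd_imp_le\<close>)
  also have "\<dots> = 1" by (simp add: coeff_0_power)
  finally show False by simp
qed

text \<open>Let \<open>q = 4 * l + 3\<close>. Hermite's criterion with exponent \<open>l + 1\<close>
  isolates the coefficient at 2 and forces \<open>a = 0\<close>. With exponent \<open>l + 2\<close>
  it isolates the coefficient at 6, which is nonzero; only for \<open>q = 7\<close> does the
  constant coefficient join in and make cancellation possible.\<close>

lemma inj_quartic_3_mod_4:
  assumes inj: "inj_on (\<lambda>x. x ^ 4 + a * x ^ 2 + b * x) K"
    and q: "q mod 4 = 3" "q \<ge> 7" and ab: "a \<in> K" "b \<in> K" and two: "(2::'a) \<noteq> 0"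
    and five: "(5::'a) \<noteq> 0"
  shows "q = 7 \<and> a = 0 \<and> b ^ 2 = 2"
proof -
  have inj': "inj_on (\<lambda>x. x ^ 4 + 0 * x ^ 3 + a * x ^ 2 + b * x) K" using inj by simp
  define l where "l = q div 4"
  have ql: "q = 4 * l + 3" "l > 0" using q unfolding l_def by presburger+
  have ql': "(4::'a) * of_nat l = - 3"
    using of_nat_q unfolding ql by (simp add: eq_neg_iff_add_eq_0)
  have a: "a = 0"
  proof -
    let ?p = "[:1, 0, a, b:]"
    let ?k = "l + 1"
    have dvd: "(q - 1) dvd (q - 3 + i) \<longleftrightarrow> i = 2" if "i \<le> 3 * ?k" for i
    proof
      assume "(q - 1) dvd (q - 3 + i)"
      then obtain j where j: "q - 3 + i = (q - 1) * j" by (auto elim: dvdE)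
      have "q - 3 + i < (q - 1) * 2" "q - 3 + i > 0"
        using that ql by simp_all
      hence "(q - 1) * j < (q - 1) * 2" "(q - 1) * j > 0" unfolding j .
      hence "j = 1" by auto
      thus "i = 2" using j ql by simp
    qed (use ql in simp)
    have "(\<Sum>i\<le>3 * ?k. if (q - 1) dvd (q - 3 + i) then coeff (?p ^ ?k) i else 0) = 0"
    proof (rule quartic_hermite[OF inj' ab])
      have "q - 3 + 4 * ?k = (q - 1) * 2" using ql by simp
      thus "(q - 1) dvd (q - 3 + 4 * ?k)" by simp
    qed (use ql in auto)
    also have "(\<Sum>i\<le>3 * ?k. if (q - 1) dvd (q - 3 + i) then coeff (?p ^ ?k) i else 0)
                 = (\<Sum>i\<in>{2}. coeff (?p ^ ?k) i)"
      by (rule sum.mono_neutral_cong_right) (use dvd dvd[of 2] in auto)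
    also have "\<dots> = of_nat ?k * a" using coeff_power_no_linear_term[of a b ?k] by simp
    finally have ka: "of_nat ?k * a = 0" .
    \<comment> \<open>Since \<open>4 * l = - 3\<close> in the field, 4 is the inverse of
      \<open>l + 1\<close>.\<close>
    have "4 * (of_nat ?k * a) = (4 * of_nat l + 4) * a"
      by (simp add: algebra_simps)
    thus "a = 0" unfolding ql' ka by simp
  qed
  let ?p = "[:1, 0, 0, b:]"
  let ?k = "l + 2"
  have "(\<Sum>i\<le>3 * ?k. if (q - 1) dvd (q - 7 + i) then coeff (?p ^ ?k) i else 0) = 0"
  proof (rule quartic_hermite[OF inj'[unfolded a]])
    have "q - 7 + 4 * ?k = (q - 1) * 2" using ql by simp
    thus "(q - 1) dvd (q - 7 + 4 * ?k)" by simp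
  qed (use ql ab in auto)
  also have "(\<Sum>i\<le>3 * ?k. if (q - 1) dvd (q - 7 + i) then coeff (?p ^ ?k) i else 0)
               = (\<Sum>i\<in>(if q = 7 then {0, 6} else {6}). coeff (?p ^ ?k) i)"
  proof (rule sum.mono_neutral_cong_right)
    have dvd: "(q - 1) dvd (q - 7 + i) \<longleftrightarrow> i = 6 \<or> q = 7 \<and> i = 0" if "i \<le> 3 * ?k" for i
    proof
      assume "(q - 1) dvd (q - 7 + i)"
      then obtain j where j: "q - 7 + i = (q - 1) * j" by (auto elim: dvdE)
      have "q - 7 + i < (q - 1) * 2"
        using that ql by simp
      hence "(q - 1) * j < (q - 1) * 2" unfolding j .
      hence "j = 0 \<or> j = 1" by auto
      thus "i = 6 \<or> q = 7 \<and> i = 0" using j ql by auto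
    qed (use ql in auto)
    show "\<forall>i\<in>{..3 * ?k} - (if q = 7 then {0, 6} else {6}).
           (if (q - 1) dvd (q - 7 + i) then coeff (?p ^ ?k) i else 0) = 0"
    proof
      fix i assume i: "i \<in> {..3 * ?k} - (if q = 7 then {0, 6} else {6})"
      hence "\<not> (q - 1) dvd (q - 7 + i)" by (subst dvd) (simp_all split: if_splits)
      thus "(if (q - 1) dvd (q - 7 + i) then coeff (?p ^ ?k) i else 0) = 0" by (rule if_not_P)
    qed
    fix i :: nat assume i: "i \<in> (if q = 7 then {0, 6} else {6})"
    hence "(q - 1) dvd (q - 7 + i)" by (subst dvd) (auto split: if_splits)
    thus "(if (q - 1) dvd (q - 7 + i) then coeff (?p ^ ?k) i else 0) = coeff (?p ^ ?k) i"
      by (rule if_P)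
  qed (auto split: if_splits)
  also have "\<dots> = of_nat (?k choose 2) * b ^ 2 + (if q = 7 then 1 else 0)"
    using coeff_power_cubic_binomial[of b ?k] by simp
  finally have *: "of_nat (?k choose 2) * b ^ 2 + (if q = 7 then 1 else (0::'a)) = 0" .
  \<comment> \<open>The factor 32 clears the denominators of \<open>l = - 3 / 4\<close>:
    \<open>(4 * l + 8) * (4 * l + 4)\<close> is 5 times 1. Hence the assumption on 5.\<close>
  have "(?k choose 2) * 2 = (l + 2) * (l + 1)"
    unfolding choose_two by simp
  from arg_cong[OF this, of "of_nat :: nat \<Rightarrow> 'a"]
  have "(of_nat (?k choose 2) * 2 :: 'a) = (of_nat l + 2) * (of_nat l + 1)"
    by (simp only: of_nat_mult of_nat_add of_nat_numeral of_nat_1)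
  hence "16 * (of_nat (?k choose 2) * 2 :: 'a) = (4 * of_nat l + 8) * (4 * of_nat l + 4)"
    by (simp add: algebra_simps)
  hence binom: "32 * (of_nat (?k choose 2) :: 'a) = 5"
    unfolding ql' by simp
  have b: "b \<noteq> 0"
  proof
    assume "b = 0"
    hence "(1::'a) = - 1" using inj_onD[OF inj, of 1 "- 1"] a by simp
    hence "(1::'a) + 1 = 0" by (simp only: eq_neg_iff_add_eq_0)
    thus False using two by simp
  qed
  have "32 * (of_nat (?k choose 2) * b ^ 2) \<noteq> 0"
    unfolding mult.assoc[symmetric] binom using b five by simp
  hence "of_nat (?k choose 2) * b ^ 2 \<noteq> 0"
    by (rule contrapos_nn) (simp only: mult_zero_right)
  hence q7: "q = 7" using * by (cases "q = 7") simp_all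
  hence "(7::'a) = 0" using of_nat_q by simp
  have "l = 1" using q7 ql by simp
  hence "?k choose 2 = 3" by (simp add: choose_two)
  with * q7 have "3 * b ^ 2 + 1 = 0" by simp
  \<comment> \<open>5 is the inverse of 3 modulo 7.\<close>
  moreover have "b ^ 2 - 2 = 5 * (3 * b ^ 2 + 1) - 7 * (2 * b ^ 2 + 1)" by algebra
  ultimately have "b ^ 2 = 2" using \<open>(7::'a) = 0\<close> by simp
  with q7 a show ?thesis by simp
qed

text \<open>The cube of the value is \<open>5 * b * x ^ 3\<close>, so the value determines
  \<open>x ^ 3\<close>. It then determines \<open>x\<close>, because the cofactor
  \<open>x ^ 3 + b\<close> is nonzero: otherwise \<open>x ^ 6 = b ^ 2 = 2\<close>, whereas sixth
  powers in \<open>K\<close> are 0 or 1.\<close>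

lemma inj_quartic_7:
  assumes "q = 7" "b \<in> K" "b ^ 2 = (2::'a)"
  shows "inj_on (\<lambda>x. x ^ 4 + b * x) K"
proof -
  have seven: "(7::'a) = 0" using of_nat_q assms(1) by simp
  have cube: "(x ^ 4 + b * x) ^ 3 = 5 * b * x ^ 3" if "x \<in> K" for x
  proof -
    have "x ^ 7 = x" using power_q[OF that] assms(1) by simp
    hence x: "x ^ 12 = x ^ 6" "x ^ 9 = x ^ 3"
      using power_add[of x 7 5] power_add[of x 7 2]
      by (simp_all add: power_numeral_reduce)
    have b: "b ^ 3 = 2 * b" using assms(3) by (simp add: power3_eq_cube power2_eq_square)
    have "(x ^ 4 + b * x) ^ 3 = x ^ 12 + 3 * b * x ^ 9 + 3 * b ^ 2 * x ^ 6 + b ^ 3 * x ^ 3"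
      by algebra
    also have "\<dots> = 7 * x ^ 6 + 5 * b * x ^ 3"
      unfolding x b assms(3) by (simp add: algebra_simps)
    finally show ?thesis using seven by simp
  qed
  have nz: "x ^ 3 + b \<noteq> 0" if "x \<in> K" for x
  proof
    assume *: "x ^ 3 + b = 0"
    show False
    proof (cases "x = 0")
      case True
      hence "b = 0" using * by simp
      hence "(2::'a) = 0" using assms(3) by simp
      hence "7 - 3 * (2::'a) = 0" using seven by simp
      thus False by simp
    next
      case False
      hence "x ^ 6 = 1" using power_q_minus_1[OF that] assms(1) by simp
      moreover have "x ^ 6 = b ^ 2" using * by algebra
      ultimately have "2 - 1 = (0::'a)" using assms(3) by simp
      thus False by simp
    qed
  qed
  have b5: "5 * b \<noteq> 0"
  proof
    assume "5 * b = 0"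
    hence "25 * b ^ 2 = 0" by algebra
    hence "25 * 2 - 7 * 7 = (0::'a)" using assms(3) seven by simp
    thus False by simp
  qed
  show ?thesis
  proof (rule inj_onI)
    fix x y assume xy: "x \<in> K" "y \<in> K" "x ^ 4 + b * x = y ^ 4 + b * y"
    hence "5 * b * x ^ 3 = 5 * b * y ^ 3" using cube by metis
    hence c: "x ^ 3 = y ^ 3" using b5 by simp
    have "(x ^ 3 + b) * x = (x ^ 3 + b) * y"
      using xy(3) c by algebra
    thus "x = y" using nz[OF xy(1)] by simp
  qed
qed

section \<open>Affine normalisation of quartics\<close>

lemma inj_on_scale_shift_iff:
  assumes "r \<in> K" "r \<noteq> 0" "d \<in> K" "\<And>x. x \<in> K \<Longrightarrow> g x = r * \<psi> (x + d) + e"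
  shows "inj_on g K \<longleftrightarrow> inj_on \<psi> K"
proof
  assume g: "inj_on g K"
  show "inj_on \<psi> K"
  proof (rule inj_onI)
    fix x y assume "x \<in> K" "y \<in> K" "\<psi> x = \<psi> y"
    thus "x = y"
      using inj_onD[OF g, of "x - d" "y - d"] assms(3) by (simp add: assms(4))
  qed
next
  assume \<psi>: "inj_on \<psi> K"
  show "inj_on g K"
  proof (rule inj_onI)
    fix x y assume "x \<in> K" "y \<in> K" "g x = g y"
    thus "x = y"
      using inj_onD[OF \<psi>, of "x + d" "y + d"] assms(2,3) by (simp add: assms(4))
  qed
qed

lemma inj_quartic_depress:
  fixes n t u :: 'a
  assumes "n \<in> K" "n \<noteq> 0" "t \<in> K" "(2::'a) \<noteq> 0"
  shows "inj_on (\<lambda>x. n * x ^ 4 + t * x ^ 3 + u * x ^ 2 + x) K \<longleftrightarrow>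
    inj_on (\<lambda>x. x ^ 4 + (u / n - 3 * t ^ 2 / (8 * n ^ 2)) * x ^ 2
      + (1 / n - t * u / (2 * n ^ 2) + t ^ 3 / (8 * n ^ 3)) * x) K"
proof -
  \<comment> \<open>The shift by \<open>d\<close> removes the cubic term; in terms of
    \<open>d\<close>, \<open>v\<close> and \<open>r\<close> the remaining identity is
    polynomial.\<close>
  define d where "d = t / (4 * n)"
  define v where "v = u / n"
  define r where "r = 1 / n"
  have four: "(4::'a) \<noteq> 0" and eight: "(8::'a) \<noteq> 0"
  proof -
    have "(4::'a) = 2 * 2" "(8::'a) = 2 * 2 * 2" by simp_all
    thus "(4::'a) \<noteq> 0" "(8::'a) \<noteq> 0" using assms(4) by (metis mult_eq_0_iff)+
  qed
  have t: "t = 4 * n * d" using assms(2) four by (simp add: d_def)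
  have u: "u = n * v" using assms(2) by (simp add: v_def)
  have nr: "n * r = 1" using assms(2) by (simp add: r_def)
  have a: "u / n - 3 * t ^ 2 / (8 * n ^ 2) = v - 6 * d ^ 2"
  proof -
    have "3 * t ^ 2 / (8 * n ^ 2) = (8 * n ^ 2) * (6 * d ^ 2) / (8 * n ^ 2)"
      unfolding t by (simp add: algebra_simps)
    also have "\<dots> = 6 * d ^ 2" using assms(2) eight by simp
    finally show ?thesis by (simp add: v_def)
  qed
  have b: "1 / n - t * u / (2 * n ^ 2) + t ^ 3 / (8 * n ^ 3) = r - 2 * d * v + 8 * d ^ 3"
  proof -
    have "t * u / (2 * n ^ 2) = (2 * n ^ 2) * (2 * d * v) / (2 * n ^ 2)"
      unfolding t u by (simp add: algebra_simps power2_eq_square)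
    also have "\<dots> = 2 * d * v" using assms(2,4) by simp
    finally have 1: "t * u / (2 * n ^ 2) = 2 * d * v" .
    have "t ^ 3 / (8 * n ^ 3) = (8 * n ^ 3) * (8 * d ^ 3) / (8 * n ^ 3)"
      unfolding t by (simp add: algebra_simps)
    also have "\<dots> = 8 * d ^ 3" using assms(2) eight by simp
    finally show ?thesis using 1 by (simp add: r_def)
  qed
  show ?thesis unfolding a b
  proof (rule inj_on_scale_shift_iff[OF assms(1,2), of d])
    show "d \<in> K" using assms by (simp add: d_def)
    fix x
    show "n * x ^ 4 + t * x ^ 3 + u * x ^ 2 + x =
      n * ((x + d) ^ 4 + (v - 6 * d ^ 2) * (x + d) ^ 2 + (r - 2 * d * v + 8 * d ^ 3) * (x + d))
       + n * (- (d ^ 4) - (v - 6 * d ^ 2) * d ^ 2 - (r - 2 * d * v + 8 * d ^ 3) * d)"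
      unfolding t u using nr by algebra
  qed
qed

end

section \<open>Quartics over finite fields of characteristic two\<close>

lemma add_power_power_2:
  fixes x y :: "'a::comm_ring_1"
  assumes "(2::'a) = 0"
  shows "(x + y) ^ (2 ^ i) = x ^ (2 ^ i) + y ^ (2 ^ i)"
proof (induction i)
  case (Suc i)
  have "(x + y) ^ (2 ^ Suc i) = (x ^ (2 ^ i) + y ^ (2 ^ i)) ^ 2"
    by (simp only: power_Suc2 power_mult Suc.IH)
  also have "\<dots> = (x ^ (2 ^ i)) ^ 2 + (y ^ (2 ^ i)) ^ 2"
    using assms by (simp add: power2_sum)
  finally show ?case by (simp only: power_Suc2 power_mult)
qed simp

context finite_subfield
begin

(* The image of z^2 + z has q/2 elements and lies in the zero set of the trace, a polynomial of degree q/2. *)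
lemma artin_schreier_solvable:
  fixes c :: 'a
  assumes "q = 2 ^ m" "(2::'a) = 0" "(\<Sum>i<m. c ^ (2 ^ i)) = 0"
  shows "\<exists>z\<in>K. z ^ 2 + z = c"
proof -
  have m: "m > 0" using q_ge_2 assms(1) by (cases m) auto
  define T :: "'a \<Rightarrow> 'a" where "T = (\<lambda>c. \<Sum>i<m. c ^ (2 ^ i))"
  let ?I = "(\<lambda>z. z ^ 2 + z) ` K" and ?Z = "{c. T c = 0}"
  have "?I \<subseteq> ?Z"
  proof clarify
    fix z assume z: "z \<in> K"
    \<comment> \<open>All inner powers occur twice and cancel, leaving
      \<open>z ^ q + z\<close>.\<close>
    have "T (z ^ 2 + z) = (\<Sum>i<m. z ^ (2 ^ Suc i) + z ^ (2 ^ i))"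
      unfolding T_def add_power_power_2[OF assms(2)] by (simp add: power_mult[symmetric])
    also have "\<dots> = z ^ (2 ^ m) + z + 2 * (\<Sum>i\<in>{1..<m}. z ^ (2 ^ i))"
    proof -
      have "(\<Sum>i<m. z ^ (2 ^ Suc i)) = z ^ (2 ^ m) + (\<Sum>i\<in>{1..<m}. z ^ (2 ^ i))"
        using m
      proof (induction m)
        case (Suc m) thus ?case by (cases "m = 0") auto
      qed simp
      moreover have "(\<Sum>i<m. z ^ (2 ^ i)) = z + (\<Sum>i\<in>{1..<m}. z ^ (2 ^ i))"
        using m by (simp add: lessThan_atLeast0 sum.atLeast_Suc_lessThan)
      ultimately show ?thesis by (simp add: sum.distrib)
    qed
    also have "\<dots> = 0"
      using power_q[OF z] assms(1,2) by (simp flip: mult_2)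
    finally show "T (z ^ 2 + z) = 0" .
  qed
  have poly: "finite ?Z \<and> card ?Z \<le> 2 ^ (m - 1)"
  proof -
    let ?p = "\<Sum>i<m. monom 1 (2 ^ i) :: 'a poly"
    have "coeff ?p (2 ^ (m - 1)) = (\<Sum>i<m. if i = m - 1 then 1 else 0)"
      unfolding coeff_sum by (rule sum.cong) auto
    also have "\<dots> = 1" using m by simp
    finally have nz: "?p \<noteq> 0" by (metis coeff_0 zero_neq_one)
    have deg: "degree ?p \<le> 2 ^ (m - 1)"
      by (rule degree_sum_le) (auto intro!: order_trans[OF degree_monom_le])
    have "poly ?p x = 0" if "x \<in> ?Z" for x
      using that by (simp add: T_def poly_sum poly_monom)
    from card_roots_le_degree[OF nz, of ?Z] this deg show ?thesis by fastforce
  qed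
  have "card K \<le> 2 * card ?I"
  proof -
    have "card K = card (\<Union>c\<in>?I. {z\<in>K. z ^ 2 + z = c})"
      by (rule arg_cong[of _ _ card]) auto
    also have "\<dots> \<le> (\<Sum>c\<in>?I. card {z\<in>K. z ^ 2 + z = c})"
      by (rule card_UN_le) (use finite_K in simp)
    also have "\<dots> \<le> (\<Sum>c\<in>?I. 2)"
    proof (rule sum_mono)
      fix c
      have "poly [:- c, 1, 1:] z = 0" if "z \<in> {z\<in>K. z ^ 2 + z = c}" for z
        using that by (auto simp: algebra_simps power2_eq_square)
      from card_roots_le_degree(2)[of "[:- c, 1, 1:]" "{z\<in>K. z ^ 2 + z = c}"] this
      show "card {z\<in>K. z ^ 2 + z = c} \<le> 2" by simp
    qed
    finally show ?thesis by simp
  qed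
  moreover have "card K = 2 * 2 ^ (m - 1)"
    using m assms(1) by (cases m) auto
  ultimately have "card ?Z \<le> card ?I" using poly by linarith
  hence "?I = ?Z"
    using card_seteq[of ?Z ?I] poly \<open>?I \<subseteq> ?Z\<close> by blast
  moreover have "c \<in> ?Z" using assms(3) by (simp add: T_def)
  ultimately have "c \<in> ?I" by simp
  thus ?thesis by (auto intro: sym)
qed

(* For t \<noteq> 0 the points x z and x z + x collide iff z^2 + z = w x, where x^(q-2) stands for 1/x.
   Hence w x has trace 1 for all x \<noteq> 0; but as a function of x its trace has the coefficient A = n/t at x. *)
lemma inj_quartic_char_2_imp_coeff_3_eq_0:
  fixes n t u :: 'a
  assumes q: "q = 2 ^ m" "q \<ge> 4" and two: "(2::'a) = 0"
    and mem: "n \<in> K" "t \<in> K" "u \<in> K" and n: "n \<noteq> 0"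
    and inj: "inj_on (\<lambda>x. n * x ^ 4 + t * x ^ 3 + u * x ^ 2 + x) K"
  shows "t = 0"
proof (cases "q = 4")
  \<comment> \<open>The extraction of \<open>A\<close> below breaks down here because
    \<open>1 + 2 = q - 1\<close>. The plain sum of all values suffices instead: of the exponents 1
    to 4 only 3 is a multiple of \<open>q - 1\<close>, which leaves \<open>- t\<close>.\<close>
  case True
  let ?g = "\<lambda>x. n * x ^ 4 + t * x ^ 3 + u * x ^ 2 + x"
  have "0 = (\<Sum>x\<in>K. ?g x ^ 1)"
    by (rule sum_power_permutation[symmetric, OF inj]) (use mem True in auto)
  also have "\<dots> = (\<Sum>x\<in>K-{0}. n * x ^ 4 + t * x ^ 3 + u * x ^ 2 + x ^ 1)"
    by (rule sum.mono_neutral_cong_right) (use finite_K in auto)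
  also have "\<dots> = n * (\<Sum>x\<in>K-{0}. x ^ 4) + t * (\<Sum>x\<in>K-{0}. x ^ 3)
      + u * (\<Sum>x\<in>K-{0}. x ^ 2) + (\<Sum>x\<in>K-{0}. x ^ 1)"
    by (simp only: sum.distrib sum_distrib_left)
  also have "\<dots> = - t"
    unfolding sum_units_power True by simp
  finally show ?thesis by simp
next
  case False
  have minus: "- x = x" for x :: 'a
    using two by (metis add_eq_0_iff2 mult_2 mult_zero_left)
  have m: "m \<ge> 3"
  proof (rule ccontr)
    assume "\<not> m \<ge> 3"
    hence "m = 0 \<or> m = 1 \<or> m = 2" by auto
    thus False using q False by auto
  qed
  have q8: "q \<ge> 8"
    using power_increasing[OF m, of "2::nat"] q(1) by simp
  show ?thesis
  proof (rule ccontr)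
    assume t: "t \<noteq> 0"
    \<comment> \<open>In characteristic 2 the values at \<open>x * z + x\<close> and
      \<open>x * z\<close> differ by \<open>t * x ^ 3\<close> times
      \<open>z^2 + z + 1 + A * x + B / x + C / x^2\<close>.\<close>
    define A B C where "A = n / t" and "B = u / t" and "C = 1 / t"
    have ABC: "A \<in> K" "B \<in> K" "C \<in> K" "A \<noteq> 0"
      using mem n t by (simp_all add: A_def B_def C_def)
    have tABC: "n = t * A" "u = t * B" "t * C = 1"
      using t by (simp_all add: A_def B_def C_def)
    define w where "w = (\<lambda>x. 1 + A * x + B * x ^ (q - 2) + C * x ^ (2 * (q - 2)))"
    define T :: "'a \<Rightarrow> 'a" where "T = (\<lambda>c. \<Sum>i<m. c ^ (2 ^ i))"
    \<comment> \<open>\<open>T\<close> is the absolute trace: squaring permutes its summands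
      cyclically.\<close>
    have T01: "T c = 0 \<or> T c = 1" if c: "c \<in> K" for c
    proof -
      have "T c ^ 2 = (\<Sum>i<m. c ^ (2 ^ Suc i))"
      proof -
        have "(\<Sum>i\<in>S. f i) ^ 2 = (\<Sum>i\<in>S. f i ^ 2)" if "finite S" for S :: "nat set" and f :: "nat \<Rightarrow> 'a"
          using that two by induction (auto simp: power2_sum)
        thus ?thesis unfolding T_def by (simp only: finite_lessThan power_Suc2 power_mult)
      qed
      also have "\<dots> = T c + (c ^ (2 ^ m) - c)"
        unfolding T_def by (induction m) auto
      also have "c ^ (2 ^ m) = c" using power_q[OF c] q(1) by simp
      finally have "T c * (T c - 1) = 0" by (simp add: power2_eq_square algebra_simps)
      thus ?thesis by auto
    qed
    have Tw: "T (w x) = 1" if x: "x \<in> K" "x \<noteq> 0" for x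
    proof (rule ccontr)
      assume "T (w x) \<noteq> 1"
      moreover have "w x \<in> K" using x ABC by (simp add: w_def)
      ultimately have "T (w x) = 0" using T01 by blast
      then obtain z where z: "z \<in> K" "z ^ 2 + z = w x"
        using artin_schreier_solvable[OF q(1) two, of "w x"] by (auto simp: T_def)
      define y where "y = x ^ (q - 2)"
      have xy: "x * y = 1"
        using power_q_minus_1[OF x] q8
        by (simp add: y_def flip: power_Suc) (metis Suc_diff_Suc Suc_1 Suc_le_lessD numeral_2_eq_2 q_ge_2)
      have w: "w x = 1 + A * x + B * y + C * y ^ 2"
        by (simp add: w_def y_def mult.commute flip: power_mult)
      let ?g = "\<lambda>x. n * x ^ 4 + t * x ^ 3 + u * x ^ 2 + x"
      \<comment> \<open>The summand with the factor 2 collects what vanishes in characteristic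
        2.\<close>
      have "?g (x * z + x) - ?g (x * z)
          = t * x ^ 3 * ((z ^ 2 + z) - (1 + A * x + B * y + C * y ^ 2))
          + 2 * (t * x ^ 3 + t * A * x ^ 4 * (2 * z ^ 3 + 3 * z ^ 2 + 2 * z + 1) + t * B * x ^ 2 * (z + 1)
               + t * x ^ 3 * (z ^ 2 + z) + x)"
      proof -
        have By: "t * x ^ 3 * (B * y) = t * B * x ^ 2" using xy by algebra
        have Cy: "t * x ^ 3 * (C * y ^ 2) = x" using xy tABC(3) by algebra
        show ?thesis unfolding tABC(1,2) ring_distribs(1) right_diff_distrib By Cy
          by algebra
      qed
      also have "\<dots> = 0"
        unfolding z(2) w two by simp
      finally have "?g (x * z + x) = ?g (x * z)" by (simp only: right_minus_eq)
      from inj_onD[OF inj this] x z(1) show False by simp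
    qed
    \<comment> \<open>\<open>q - 2\<close> is -1 modulo \<open>q - 1\<close>.\<close>
    have cop: "(q - 1) dvd (q - 2) * j \<longleftrightarrow> (q - 1) dvd j" for j
    proof -
      have "coprime (q - 1) (q - 2)"
        using coprime_Suc_right_nat[of "q - 2"] q8 by (simp add: coprime_commute Suc_diff_Suc numeral_2_eq_2)
      thus ?thesis by (rule coprime_dvd_mult_right_iff)
    qed
    have pow: "2 ^ i * 2 \<le> q" if "i < m" for i
      using power_increasing[of "Suc i" m "2::nat"] that q(1) by simp
    have d1: "(q - 1) dvd (q - 2 + 2 ^ i) \<longleftrightarrow> i = 0" if i: "i < m" for i
    proof
      assume "(q - 1) dvd (q - 2 + 2 ^ i)"
      moreover have "q - 2 + 2 ^ i = (q - 1) + (2 ^ i - 1)" using q8 by simp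
      ultimately have "(q - 1) dvd (2 ^ i - 1)" by (metis dvd_add_right_iff dvd_refl)
      moreover have "2 ^ i - 1 < q - 1" using pow[OF i] q8 by linarith
      ultimately have "2 ^ i - (1::nat) = 0" by (metis dvd_imp_le gr0I not_le)
      hence "2 ^ i \<le> (2 ^ 0 :: nat)" by simp
      thus "i = 0" by (subst (asm) power_increasing_iff) auto
    next
      assume "i = 0" thus "(q - 1) dvd (q - 2 + 2 ^ i)" using q8 by (simp add: Suc_diff_Suc numeral_2_eq_2)
    qed
    have d2: "\<not> (q - 1) dvd (q - 2 + (q - 2) * 2 ^ i)" if i: "i < m" for i
    proof -
      have "q - 2 + (q - 2) * 2 ^ i = (q - 2) * (1 + 2 ^ i)" by simp
      moreover have "\<not> (q - 1) dvd (1 + 2 ^ i)"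
        using pow[OF i] q8 by (auto dest!: dvd_imp_le)
      ultimately show ?thesis using cop by metis
    qed
    have d3: "\<not> (q - 1) dvd (q - 2 + 2 * (q - 2) * 2 ^ i)" if i: "i < m" for i
    proof -
      have eq: "q - 2 + 2 * (q - 2) * 2 ^ i = (q - 2) * (1 + 2 ^ Suc i)" by simp
      have "\<not> (q - 1) dvd (1 + 2 ^ Suc i)"
      \<comment> \<open>For the last index \<open>2 ^ Suc i\<close> is \<open>q\<close> itself,
        which is 1 modulo \<open>q - 1\<close>.\<close>
      proof (cases "Suc i = m")
        case True
        hence "1 + 2 ^ Suc i = (q - 1) + 2" using q(1) q8 by simp
        moreover have "\<not> (q - 1) dvd 2" using q8 by (auto dest!: dvd_imp_le)
        ultimately show ?thesis by (metis dvd_add_right_iff dvd_refl)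
      next
        case False
        hence "Suc i < m" using i by simp
        from pow[OF this] show ?thesis using q8 by (auto dest!: dvd_imp_le)
      qed
      thus ?thesis unfolding eq using cop by metis
    qed
    \<comment> \<open>The weight \<open>x ^ (q - 2)\<close>, that is \<open>1 / x\<close>, extracts
      the coefficient at \<open>x\<close>. By \<open>Tw\<close> the trace is constant, which gives
      0; by \<open>d1\<close>, \<open>d2\<close> and \<open>d3\<close> its expansion gives
      \<open>- A\<close>.\<close>
    have "(\<Sum>x\<in>K-{0}. x ^ (q - 2) * T (w x)) = (\<Sum>x\<in>K-{0}. x ^ (q - 2))"
      by (rule sum.cong) (use Tw in auto)
    also have "\<dots> = 0"
      unfolding sum_units_power using q8 by (auto dest!: dvd_imp_le)
    finally have "0 = (\<Sum>x\<in>K-{0}. x ^ (q - 2) * T (w x))" ..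
    also have "\<dots> = (\<Sum>x\<in>K-{0}. \<Sum>i<m. x ^ (q - 2) + A ^ (2 ^ i) * x ^ (q - 2 + 2 ^ i)
        + B ^ (2 ^ i) * x ^ (q - 2 + (q - 2) * 2 ^ i) + C ^ (2 ^ i) * x ^ (q - 2 + 2 * (q - 2) * 2 ^ i))"
      unfolding T_def w_def add_power_power_2[OF two] sum_distrib_left
      by (intro sum.cong refl) (simp only: power_one power_mult_distrib power_add power_mult[symmetric] distrib_left mult_1_left mult_1_right mult_ac)
    also have "\<dots> = (\<Sum>i<m. (\<Sum>x\<in>K-{0}. x ^ (q - 2)) + A ^ (2 ^ i) * (\<Sum>x\<in>K-{0}. x ^ (q - 2 + 2 ^ i))
        + B ^ (2 ^ i) * (\<Sum>x\<in>K-{0}. x ^ (q - 2 + (q - 2) * 2 ^ i))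
        + C ^ (2 ^ i) * (\<Sum>x\<in>K-{0}. x ^ (q - 2 + 2 * (q - 2) * 2 ^ i)))"
      by (subst sum.swap) (simp only: sum.distrib sum_distrib_left)
    also have "\<dots> = (\<Sum>i<m. if i = 0 then - A else 0)"
      unfolding sum_units_power using d1 d2 d3 q8
      by (intro sum.cong) (auto dest!: dvd_imp_le)
    also have "\<dots> = - A" using m by simp
    finally show False using ABC(4) by simp
  qed
qed

text \<open>The polynomial is additive, so a collision of \<open>x\<close> and \<open>y\<close>
  would make \<open>x - y\<close> a nonzero root.\<close>

lemma inj_quartic_char_2:
  fixes n u :: 'a
  assumes "(2::'a) = 0" "n \<in> K" "u \<in> K"
    and "\<And>x. x \<in> K \<Longrightarrow> x \<noteq> 0 \<Longrightarrow> n * x ^ 4 + u * x ^ 2 + x \<noteq> 0"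
  shows "inj_on (\<lambda>x. n * x ^ 4 + u * x ^ 2 + x) K"
proof (rule inj_onI)
  fix x y assume *: "x \<in> K" "y \<in> K" "n * x ^ 4 + u * x ^ 2 + x = n * y ^ 4 + u * y ^ 2 + y"
  have "n * (x - y) ^ 4 + u * (x - y) ^ 2 + (x - y)
    = (n * x ^ 4 + u * x ^ 2 + x) - (n * y ^ 4 + u * y ^ 2 + y)
      + 2 * (n * (- 2 * x ^ 3 * y + 3 * x ^ 2 * y ^ 2 - 2 * x * y ^ 3 + y ^ 4) + u * (y ^ 2 - x * y))"
    by algebra
  hence "n * (x - y) ^ 4 + u * (x - y) ^ 2 + (x - y) = 0"
    using * assms(1) by simp
  thus "x = y" using assms(4)[of "x - y"] *(1,2) by auto
qed

end

section \<open>The norm of a cubic extension\<close>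

locale cubic_extension = finite_subfield K for K :: "'a::{field,finite} set" +
  assumes card_UNIV: "CARD('a) = card K ^ 3" and primepow_q: "primepow (card K)"
begin

text \<open>Viewing the whole field as its own subfield provides
  \<open>x ^ (q ^ 3) = x\<close>.\<close>

sublocale whole: finite_subfield "UNIV :: 'a set"
  by standard (auto simp: is_subfield_def)

definition norm_K :: "'a \<Rightarrow> 'a" where
  "norm_K x = x ^ (q ^ 2) * x ^ q * x"

section \<open>Characteristic, Frobenius map and norm\<close>

lemma char_K: obtains p m where "prime p" "m > 0" "q = p ^ m" "CHAR('a) = p"
proof -
  obtain p m where pm: "prime p" "m > 0" "q = p ^ m"
    using primepow_q by (auto simp: primepow_def)
  have "of_nat (p ^ (m * 3)) = (0::'a)"
    using of_nat_q pm(3) by (simp add: power_mult)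
  hence "of_nat p = (0::'a)" by simp
  hence "CHAR('a) dvd p" by (simp add: of_nat_eq_0_iff_char_dvd)
  hence "CHAR('a) = p" using pm(1) CHAR_not_1'[where 'a = 'a]
    by (auto simp: prime_nat_iff)
  thus ?thesis using that pm by blast
qed

lemma even_iff: "even q \<longleftrightarrow> (2::'a) = 0"
proof -
  obtain p m where pm: "prime p" "m > 0" "q = p ^ m" "CHAR('a) = p" by (rule char_K)
  have "even q \<longleftrightarrow> 2 dvd p" using pm by simp
  also have "\<dots> \<longleftrightarrow> p = 2" using primes_dvd_imp_eq[OF two_is_prime_nat pm(1)] by auto
  also have "\<dots> \<longleftrightarrow> p dvd 2" using primes_dvd_imp_eq[OF pm(1) two_is_prime_nat] by auto
  also have "\<dots> \<longleftrightarrow> of_nat 2 = (0::'a)" unfolding of_nat_eq_0_iff_char_dvd pm(4) ..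
  finally show ?thesis by simp
qed

lemma numeral_eq_0_imp_q_power:
  assumes "(numeral r :: 'a) = 0" "prime (numeral r :: nat)"
  shows "\<exists>m. q = numeral r ^ m"
proof -
  obtain p m where pm: "prime p" "m > 0" "q = p ^ m" "CHAR('a) = p" by (rule char_K)
  have "of_nat (numeral r) = (0::'a)" using assms(1) by simp
  hence "p dvd numeral r" unfolding of_nat_eq_0_iff_char_dvd pm(4) .
  hence "p = numeral r" using assms(2) pm(1) primes_dvd_imp_eq by blast
  thus ?thesis using pm by auto
qed

lemma frobenius_add: "(x + y) ^ q = x ^ q + (y ^ q :: 'a)"
proof -
  obtain p m where "prime p" "m > 0" "q = p ^ m" "CHAR('a) = p" by (rule char_K)
  thus ?thesis by (intro freshmans_dream') auto
qed

lemma frobenius_cube: "((x ^ q) ^ q) ^ q = (x::'a)"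
  using whole.power_q[of x] card_UNIV
  by (simp add: power_mult[symmetric] power3_eq_cube)

lemma power_q_sq: "x ^ (q ^ 2) = ((x::'a) ^ q) ^ q"
  by (simp add: power2_eq_square power_mult)

lemma norm_K_eq_power: "norm_K x = x ^ (q ^ 2 + q + 1)"
  by (simp add: norm_K_def power_add)

lemma norm_K_mem [simp]: "norm_K x \<in> K"
  unfolding mem_iff_power_q norm_K_def power_q_sq
  by (simp add: power_mult_distrib frobenius_cube mult_ac)

lemma norm_K_mult: "norm_K (x * y) = norm_K x * norm_K y"
  by (simp add: norm_K_def power_mult_distrib mult_ac)

lemma norm_K_eq_0_iff [simp]: "norm_K x = 0 \<longleftrightarrow> x = 0"
  using q_ge_2 by (auto simp: norm_K_def)

lemma norm_K_0 [simp]: "norm_K 0 = 0"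
  by simp

definition trace1 :: "'a \<Rightarrow> 'a" where
  "trace1 x = x ^ (q ^ 2) + x ^ q + x"

text \<open>The second elementary symmetric function of the conjugates.\<close>

definition trace2 :: "'a \<Rightarrow> 'a" where
  "trace2 x = x ^ (q ^ 2) * x ^ q + x ^ (q ^ 2) * x + x ^ q * x"

lemma trace1_mem [simp]: "trace1 x \<in> K"
  unfolding mem_iff_power_q trace1_def power_q_sq
  by (simp add: frobenius_add frobenius_cube)

lemma trace2_mem [simp]: "trace2 x \<in> K"
  unfolding mem_iff_power_q trace2_def power_q_sq
  by (simp add: frobenius_add power_mult_distrib frobenius_cube mult_ac)

lemma char_poly: "x ^ 3 - trace1 x * x ^ 2 + trace2 x * x - norm_K x = 0"
  unfolding trace1_def trace2_def norm_K_def by algebra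

text \<open>Frobenius fixes \<open>s\<close> and \<open>b\<close>, so the conjugates of
  \<open>x * s + b\<close> arise by replacing \<open>x\<close> with its conjugates; their product
  expands in the symmetric functions.\<close>

lemma norm_K_affine:
  assumes "s \<in> K" "b \<in> K"
  shows "norm_K (x * s + b) = norm_K x * s ^ 3 + trace2 x * s ^ 2 * b + trace1 x * s * b ^ 2 + b ^ 3"
proof -
  have "(x * s + b) ^ q = x ^ q * s + b"
    using assms by (simp add: frobenius_add power_mult_distrib power_q)
  moreover have "(x ^ q * s + b) ^ q = (x ^ q) ^ q * s + b"
    using assms by (simp add: frobenius_add power_mult_distrib power_q)
  ultimately have "norm_K (x * s + b) = ((x ^ q) ^ q * s + b) * (x ^ q * s + b) * (x * s + b)"
    by (simp add: norm_K_def power_q_sq)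
  also have "(z * s + b) * (y * s + b) * (x * s + b) = z * y * x * s ^ 3
      + (z * y + z * x + y * x) * s ^ 2 * b + (z + y + x) * s * b ^ 2 + b ^ 3" for y z
    by algebra
  finally show ?thesis
    unfolding norm_K_def trace1_def trace2_def power_q_sq .
qed

text \<open>Norm fibres have at most \<open>q ^ 2 + q + 1\<close> elements, so the
  \<open>(q - 1) * (q ^ 2 + q + 1)\<close> units of the extension need at least \<open>q - 1\<close>
  norms.\<close>

lemma norm_K_surj: "norm_K ` UNIV = K"
proof -
  let ?I = "norm_K ` (UNIV - {0})"
  have sub: "?I \<subseteq> K - {0}"
  proof (rule image_subsetI)
    fix x :: 'a assume "x \<in> UNIV - {0}"
    thus "norm_K x \<in> K - {0}" by simp
  qed
  have "card (UNIV - {0::'a}) = card (\<Union>c\<in>?I. {x. norm_K x = c})"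
    by (rule arg_cong[of _ _ card]) auto
  also have "\<dots> \<le> (\<Sum>c\<in>?I. card {x. norm_K x = c})"
    by (rule card_UN_le) simp
  also have "\<dots> \<le> (\<Sum>c\<in>?I. q ^ 2 + q + 1)"
  proof (rule sum_mono)
    fix c
    let ?p = "monom 1 (q ^ 2 + q + 1) - [:c:] :: 'a poly"
    have "coeff ?p (q ^ 2 + q + 1) = 1" by (simp add: coeff_pCons)
    hence nz: "?p \<noteq> 0" by (metis coeff_0 zero_neq_one)
    have deg: "degree ?p \<le> q ^ 2 + q + 1"
      by (intro degree_diff_le degree_monom_le) simp
    have "card {x. norm_K x = c} \<le> degree ?p"
      by (rule card_roots_le_degree(2)[OF nz]) (simp add: poly_monom norm_K_eq_power)
    thus "card {x. norm_K x = c} \<le> q ^ 2 + q + 1" using deg by linarith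
  qed
  finally have "q ^ 3 - 1 \<le> card ?I * (q ^ 2 + q + 1)"
    using card_UNIV by simp
  moreover have "q ^ 3 - 1 = (q - 1) * (q ^ 2 + q + 1)"
  proof -
    obtain r where "q = Suc r" using q_ge_2 by (cases q) auto
    thus ?thesis by (simp add: eval_nat_numeral algebra_simps)
  qed
  ultimately have "(q - 1) * (q ^ 2 + q + 1) \<le> card ?I * (q ^ 2 + q + 1)" by metis
  hence "q - 1 \<le> card ?I" by (rule mult_right_le_imp_le) simp
  hence "?I = K - {0}"
    using card_seteq[OF _ sub] finite_K card_units by simp
  moreover have "norm_K 0 = 0" by simp
  moreover have "norm_K ` UNIV = insert (norm_K 0) ?I" by auto
  ultimately show ?thesis by auto
qed

text \<open>The norm intertwines \<open>?f\<close> with \<open>?h\<close>, so surjectivity passes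
  down to \<open>K\<close>. Conversely, if \<open>?h\<close> is injective, points with equal values
  have equal norms and hence the same cofactor \<open>a * norm_K x + b\<close>; it can be cancelled
  unless it is 0, and then injectivity at 0 gives \<open>x = 0\<close>.\<close>

lemma bij_iff_inj_on_norm:
  assumes "b \<in> K"
  shows "bij (\<lambda>x. a * x ^ (q ^ 2 + q + 2) + b * x) \<longleftrightarrow>
    inj_on (\<lambda>t. t * norm_K (a * t + b)) K"
    (is "bij ?f \<longleftrightarrow> inj_on ?h K")
proof -
  have f: "?f x = x * (a * norm_K x + b)" for x
    by (simp add: norm_K_eq_power algebra_simps)
  have Nf: "norm_K (?f x) = ?h (norm_K x)" for x
    unfolding f norm_K_mult ..
  show ?thesis
  proof
    assume "bij ?f"
    have "K \<subseteq> ?h ` K"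
    proof
      fix t assume "t \<in> K"
      then obtain x where x: "t = norm_K x" using norm_K_surj by blast
      obtain y where "x = ?f y" using \<open>bij ?f\<close> by (blast elim: bij_pointE)
      with x have "t = norm_K (?f y)" by simp
      hence "t = ?h (norm_K y)" unfolding Nf .
      thus "t \<in> ?h ` K" by auto
    qed
    hence "card (?h ` K) = card K"
      using finite_K by (intro antisym card_image_le card_mono) auto
    thus "inj_on ?h K"
      using finite_K by (intro eq_card_imp_inj_on)
  next
    assume h: "inj_on ?h K"
    have "inj ?f"
    proof (rule injI)
      fix x y assume eq: "?f x = ?f y"
      hence "?h (norm_K x) = ?h (norm_K y)" unfolding Nf[symmetric] by simp
      hence N: "norm_K x = norm_K y" by (rule inj_onD[OF h]) simp_all
      show "x = y"
      proof (cases "a * norm_K x + b = 0")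
        case True
        hence "?h (norm_K x) = ?h 0" by simp
        hence "norm_K x = 0" by (rule inj_onD[OF h]) simp_all
        thus ?thesis using N by simp
      next
        case False
        thus ?thesis using eq N unfolding f by simp
      qed
    qed
    thus "bij ?f" by (simp add: bij_def finite_UNIV_inj_surj)
  qed
qed

section \<open>Reduction to a quartic free of \<open>b\<close>\<close>

abbreviation quartic :: "'a \<Rightarrow> 'a \<Rightarrow> 'a" where
  "quartic a \<equiv> \<lambda>s. norm_K a * s ^ 4 + trace2 a * s ^ 3 + trace1 a * s ^ 2 + s"

lemma inj_on_norm_affine_iff:
  assumes "b \<in> K" "b \<noteq> 0"
  shows "inj_on (\<lambda>t. t * norm_K (a * t + b)) K \<longleftrightarrow> inj_on (quartic a) K"
proof -
  let ?h = "\<lambda>t. t * norm_K (a * t + b)"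
  have h: "?h (b * s) = b ^ 4 * quartic a s" if "s \<in> K" for s
  proof -
    have "?h (b * s) = b * s * (norm_K a * (b * s) ^ 3 + trace2 a * (b * s) ^ 2 * b
                               + trace1 a * (b * s) * b ^ 2 + b ^ 3)"
      using norm_K_affine[of "b * s" b a] that assms(1) by simp
    also have "\<dots> = b ^ 4 * quartic a s" by algebra
    finally show ?thesis .
  qed
  show ?thesis
  proof
    assume inj: "inj_on ?h K"
    show "inj_on (quartic a) K"
    proof (rule inj_onI)
      fix x y assume "x \<in> K" "y \<in> K" "quartic a x = quartic a y"
      thus "x = y" using inj_onD[OF inj, of "b * x" "b * y"] h assms by simp
    qed
  next
    assume inj: "inj_on (quartic a) K"
    show "inj_on ?h K"
    proof (rule inj_onI)
      fix x y assume *: "x \<in> K" "y \<in> K" "?h x = ?h y"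
      have "b ^ 4 * quartic a (x / b) = b ^ 4 * quartic a (y / b)"
        using h[of "x / b"] h[of "y / b"] * assms by simp
      hence "quartic a (x / b) = quartic a (y / b)" using assms(2) by simp
      from inj_onD[OF inj this] * assms show "x = y" by simp
    qed
  qed
qed

text \<open>The map is \<open>norm_K a * t ^ 4\<close>: 1 and -1 collide unless the characteristic
  is 2, where \<open>(x - y) ^ 4 = x ^ 4 - y ^ 4\<close>.\<close>

lemma inj_on_norm_monomial_iff:
  assumes "a \<noteq> 0"
  shows "inj_on (\<lambda>t. t * norm_K (a * t + 0)) K \<longleftrightarrow> even q"
proof -
  have h: "t * norm_K (a * t + 0) = norm_K a * t ^ 4" if "t \<in> K" for t
    using norm_K_affine[of t 0 a] that by (simp add: power_numeral_reduce)
  show ?thesis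
  proof
    assume inj: "inj_on (\<lambda>t. t * norm_K (a * t + 0)) K"
    have "1 * norm_K (a * 1 + 0) = (- 1) * norm_K (a * (- 1) + 0)"
      using h[of 1] h[of "- 1"] by simp
    from inj_onD[OF inj this] have "(1::'a) = - 1" by simp
    hence "(1::'a) + 1 = 0" by (simp only: eq_neg_iff_add_eq_0)
    thus "even q" using even_iff by simp
  next
    assume "even q"
    hence two: "(2::'a) = 0" using even_iff by simp
    show "inj_on (\<lambda>t. t * norm_K (a * t + 0)) K"
    proof (rule inj_onI)
      fix x y assume *: "x \<in> K" "y \<in> K" "x * norm_K (a * x + 0) = y * norm_K (a * y + 0)"
      hence "x ^ 4 = y ^ 4" using assms h by simp
      moreover have "(x - y) ^ 4 = x ^ 4 - y ^ 4
          + 2 * (y ^ 4 - 2 * x * y ^ 3 + 3 * x ^ 2 * y ^ 2 - 2 * x ^ 3 * y)"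
        by algebra
      ultimately have "(x - y) ^ 4 = 0" using two by simp
      thus "x = y" by simp
    qed
  qed
qed

text \<open>Adding the identity only replaces \<open>b\<close> by \<open>b + 1\<close>. At least one
  of the two is nonzero and requires the quartic to be injective; if the other is 0,
  \<open>q\<close> must be even.\<close>

lemma complete_iff:
  assumes "a \<noteq> 0" "b \<in> K"
  shows "complete_permutation_polynomial (monom a (q ^ 2 + q + 2) + monom b 1) \<longleftrightarrow>
    inj_on (quartic a) K \<and> (even q \<or> b \<notin> {0, - 1})"
proof -
  have perm: "permutation_polynomial (monom a (q ^ 2 + q + 2) + monom c 1) \<longleftrightarrow>
    (if c = 0 then even q else inj_on (quartic a) K)" if "c \<in> K" for c
  proof -
    have "poly (monom a (q ^ 2 + q + 2) + monom c 1) = (\<lambda>x. a * x ^ (q ^ 2 + q + 2) + c * x)"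
      by (simp add: fun_eq_iff poly_monom)
    thus ?thesis
      unfolding permutation_polynomial_def
      using bij_iff_inj_on_norm[OF that, of a] inj_on_norm_monomial_iff[OF assms(1)]
        inj_on_norm_affine_iff[OF that, of a] by simp
  qed
  have sum: "monom a (q ^ 2 + q + 2) + monom b 1 + [:0, 1:] = monom a (q ^ 2 + q + 2) + monom (b + 1) 1"
    by (simp add: monom_altdef algebra_simps flip: add_monom)
  have mem: "b + 1 \<in> K" using assms(2) by simp
  have "b + 1 = 0 \<longleftrightarrow> b = - 1" by (simp add: add_eq_0_iff2)
  thus ?thesis
    unfolding complete_permutation_polynomial_def sum perm[OF assms(2)] perm[OF mem] by auto
qed

end

section \<open>The classification\<close>

context cubic_extension
begin

text \<open>The norm form exhibits the zeros in \<open>K\<close>: besides 0, only \<open>s\<close>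
  with \<open>a * s = - 1\<close>.\<close>

lemma quartic_eq: "s \<in> K \<Longrightarrow> quartic a s = s * norm_K (a * s + 1)"
  unfolding norm_K_affine[OF _ closed(2)] power_one mult_1_right by algebra

section \<open>Even \<open>q\<close>\<close>

lemma inj_quartic_iff_q_2:
  assumes "q = 2"
  shows "inj_on (quartic a) K \<longleftrightarrow> a \<noteq> 1"
proof -
  have "{0, 1} = K"
    by (rule card_subset_eq[OF finite_K]) (use assms in auto)
  hence "inj_on (quartic a) K \<longleftrightarrow> quartic a 1 \<noteq> quartic a 0"
    by (auto simp: inj_on_def)
  also have "\<dots> \<longleftrightarrow> a + 1 \<noteq> 0"
    using quartic_eq[of 1 a] quartic_eq[of 0 a] by simp
  also have "\<dots> \<longleftrightarrow> a \<noteq> 1"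
  proof -
    have "(1::'a) + 1 = 0" using assms even_iff by simp
    hence "1 = - (1::'a)" by (simp only: eq_neg_iff_add_eq_0)
    thus ?thesis by (metis eq_neg_iff_add_eq_0)
  qed
  finally show ?thesis .
qed

text \<open>Once \<open>trace2 a = 0\<close>, the quartic is additive. A nonzero root in
  \<open>K\<close> would put \<open>a\<close> into \<open>K\<close>, where
  \<open>trace2 a = 3 * a ^ 2\<close> is nonzero.\<close>

lemma inj_quartic_iff_even:
  assumes "even q" "q > 2" "a \<noteq> 0"
  shows "inj_on (quartic a) K \<longleftrightarrow> trace2 a = 0"
proof
  have two: "(2::'a) = 0" using assms(1) even_iff by simp
  obtain m where m: "q = 2 ^ m"
    using numeral_eq_0_imp_q_power[OF two two_is_prime_nat] by auto
  have "q \<ge> 4" using assms(1,2) by presburger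
  moreover assume "inj_on (quartic a) K"
  ultimately show "trace2 a = 0"
    using assms(3) by (intro inj_quartic_char_2_imp_coeff_3_eq_0[OF m _ two]) auto
next
  have two: "(2::'a) = 0" using assms(1) even_iff by simp
  assume t: "trace2 a = 0"
  have "norm_K a * x ^ 4 + trace1 a * x ^ 2 + x \<noteq> 0" if x: "x \<in> K" "x \<noteq> 0" for x
  proof
    assume "norm_K a * x ^ 4 + trace1 a * x ^ 2 + x = 0"
    hence "quartic a x = 0" using t by simp
    hence "a * x + 1 = 0" using quartic_eq[OF x(1), of a] x(2) by simp
    hence a: "a = - 1 / x" using x(2) by (simp add: field_simps add_eq_0_iff)
    hence "a \<in> K" using x(1) by simp
    hence "trace2 a = a ^ 2 + 2 * a ^ 2"
      unfolding trace2_def power_q_sq by (simp add: power_q) algebra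
    thus False using t two assms(3) by simp
  qed
  from inj_quartic_char_2[OF two _ _ this] show "inj_on (quartic a) K"
    using t by simp
qed

text \<open>The right-hand sum is \<open>trace2 a\<close> divided by \<open>a ^ q\<close>.\<close>

lemma trace2_eq_0_iff:
  assumes "a \<noteq> 0"
  shows "trace2 a = 0 \<longleftrightarrow> a ^ (q ^ 2) + a ^ (q ^ 2 - q + 1) + a = 0"
proof -
  have "q \<le> q ^ 2" by (simp add: power2_eq_square)
  hence "a ^ (q ^ 2 - q + 1) * a ^ q = a ^ (q ^ 2) * a"
    by (simp flip: power_add power_Suc2)
  hence "trace2 a = (a ^ (q ^ 2) + a ^ (q ^ 2 - q + 1) + a) * a ^ q"
    unfolding trace2_def distrib_right by (simp only: mult.commute)
  thus ?thesis using assms by simp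
qed

section \<open>Odd \<open>q\<close>: the cases 3 and 7, and the exclusion of all others\<close>

lemma inj_quartic_iff_q_3:
  assumes "q = 3" "a \<noteq> 0"
  shows "inj_on (quartic a) K \<longleftrightarrow> a ^ 12 + a ^ 8 + a ^ 2 + 1 = 0"
proof -
  have three: "(3::'a) = 0" using of_nat_q assms(1) by simp
  have "norm_K a + trace1 a = a * (a ^ 12 + a ^ 8 + a ^ 2 + 1)"
    unfolding norm_K_def trace1_def assms(1) by (simp, algebra)
  hence "a ^ 12 + a ^ 8 + a ^ 2 + 1 = 0 \<longleftrightarrow> norm_K a + trace1 a = 0"
    using assms(2) by simp
  also have "\<dots> \<longleftrightarrow> inj_on (quartic a) K"
  proof
    assume *: "norm_K a + trace1 a = 0"
    \<comment> \<open>On \<open>K\<close> the quartic will reduce to a linear map with this slope.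
      Slope 0 would factor the characteristic polynomial as
      \<open>(X - 1) * (X + 1) * (X - trace1 a)\<close> and put \<open>a\<close> into
      \<open>K\<close>, where \<open>trace1 a = 3 * a = 0\<close> but the norm is
      \<open>a ^ 3\<close>.\<close>
    have t2: "trace2 a + 1 \<noteq> 0"
    proof
      assume "trace2 a + 1 = 0"
      hence "(a - 1) * (a + 1) * (a - trace1 a) = 0"
        using * char_poly[of a] by algebra
      hence "a = 1 \<or> a = - 1 \<or> a = trace1 a"
        by (auto simp: eq_neg_iff_add_eq_0)
      hence "a \<in> K" by (metis closed(2,5) trace1_mem)
      hence "trace1 a = 3 * a" "norm_K a = a ^ 3"
        by (simp_all add: trace1_def norm_K_def power_q_sq power_q power3_eq_cube)
      thus False using * three assms(2) by simp
    qed
    have "quartic a x = (trace2 a + 1) * x" if "x \<in> K" for x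
    proof -
      have "x ^ 3 = x" using power_q[OF that] assms(1) by simp
      moreover from this have "x ^ 4 = x ^ 2"
        using power_add[of x 3 1] by (simp add: power2_eq_square)
      ultimately have "quartic a x = norm_K a * x ^ 2 + trace2 a * x + trace1 a * x ^ 2 + x"
        by (simp only:)
      also have "\<dots> = (norm_K a + trace1 a) * x ^ 2 + (trace2 a + 1) * x"
        by algebra
      finally show ?thesis using * by simp
    qed
    thus "inj_on (quartic a) K" using t2 by (intro inj_onI) simp
  next
    assume inj: "inj_on (quartic a) K"
    \<comment> \<open>Of the exponents 1 to 4, the multiples of \<open>q - 1\<close> are 2 and
      4.\<close>
    have "0 = (\<Sum>x\<in>K. quartic a x ^ 1)"
      by (rule sum_power_permutation[symmetric, OF inj]) (use assms in auto)
    also have "\<dots> = (\<Sum>x\<in>K-{0}. norm_K a * x ^ 4 + trace2 a * x ^ 3 + trace1 a * x ^ 2 + x ^ 1)"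
      by (rule sum.mono_neutral_cong_right) (use finite_K in auto)
    also have "\<dots> = norm_K a * (\<Sum>x\<in>K-{0}. x ^ 4) + trace2 a * (\<Sum>x\<in>K-{0}. x ^ 3)
        + trace1 a * (\<Sum>x\<in>K-{0}. x ^ 2) + (\<Sum>x\<in>K-{0}. x ^ 1)"
      by (simp only: sum.distrib sum_distrib_left)
    also have "\<dots> = - (norm_K a + trace1 a)"
      unfolding sum_units_power assms(1) by simp
    finally have "- (norm_K a + trace1 a) = 0" ..
    thus "norm_K a + trace1 a = 0" by (simp only: neg_equal_0_iff_equal)
  qed
  finally show ?thesis ..
qed

text \<open>The hypotheses encode a depressed quartic \<open>x^4 + B * x\<close> with
  \<open>B ^ 2 = 2\<close>. If \<open>trace2 a = 0\<close>, then \<open>a\<close> is a cube root of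
  its norm; otherwise \<open>a\<close> is a root of one fixed cubic times an element of
  \<open>K\<close>.\<close>

lemma q_7_conditions_imp:
  assumes "q = 7" "a \<noteq> 0"
    and P1: "trace1 a * norm_K a = 3 * trace2 a ^ 2"
    and P2: "(norm_K a ^ 2 + 3 * trace2 a ^ 3) ^ 2 = 2"
  shows "2 * a ^ 24 + 4 * a ^ 12 + a ^ 6 + 1 = 0"
proof -
  define n t u where "n = norm_K a" and "t = trace2 a" and "u = trace1 a"
  have seven: "(7::'a) = 0" using of_nat_q assms(1) by simp
  have n: "n \<noteq> 0" "n ^ 6 = 1"
    using power_q_minus_1[of n] assms(1,2) by (auto simp: n_def)
  note P1 = P1[folded n_def t_def u_def] and P2 = P2[folded n_def t_def]
  have char: "a ^ 3 = u * a ^ 2 - t * a + n"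
    using char_poly[of a] unfolding n_def t_def u_def by algebra
  show ?thesis
  proof (cases "t = 0")
    case True
    hence "u = 0" using P1 n by simp
    with True char have a3: "a ^ 3 = n" by simp
    have n4: "n ^ 4 = 2" using P2 True by (simp flip: power_mult)
    have "n ^ 2 * 2 = 1" using n(2) n4 power_add[of n 2 4] by simp
    have a: "a ^ 6 = n ^ 2" "a ^ 12 = n ^ 4" "a ^ 24 = (n ^ 4) ^ 2"
      unfolding a3[symmetric] by (simp_all flip: power_mult)
    have "2 * a ^ 24 + 4 * a ^ 12 + a ^ 6 + 1 = 7 * (2 + n ^ 2) - 3 * (n ^ 2 * 2 - 1)"
      unfolding a n4 by simp
    thus ?thesis using \<open>n ^ 2 * 2 = 1\<close> seven by simp
  next
    case False
    have t6: "t ^ 6 = 1"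
      using power_q_minus_1[of t] assms(1) False by (auto simp: t_def)
    \<comment> \<open>With \<open>t ^ 6 = 1\<close>, \<open>P2\<close> modulo 7 reads
      \<open>n ^ 4 + 6 * n ^ 2 * t ^ 3 = 0\<close>.\<close>
    have "n ^ 2 * (n ^ 2 - t ^ 3) = (n ^ 2 + 3 * t ^ 3) ^ 2 - 2 - 9 * (t ^ 6 - 1) - 7 * (1 + n ^ 2 * t ^ 3)"
      by algebra
    also have "\<dots> = 0" unfolding P2 t6 seven by simp
    finally have nt: "n ^ 2 = t ^ 3" using n by simp
    (* Now t = c^2, n = c^3 and u = 3 c, so scaling by c leaves a single cubic for a / c. *)
    define c where "c = n / t"
    have c2: "t = c ^ 2" using nt False by (simp add: c_def field_simps power2_eq_square power3_eq_cube)
    have c3: "n = c ^ 3"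
    proof -
      have "n = c * t" using False by (simp add: c_def)
      thus ?thesis unfolding c2 by algebra
    qed
    have c0: "c \<noteq> 0" using n c3 by auto
    have "u * c ^ 3 = 3 * c * c ^ 3" using P1 unfolding c2 c3 by algebra
    hence u: "u = 3 * c" using c0 by simp
    define y where "y = a / c"
    have ay: "a = c * y" using c0 by (simp add: y_def)
    have "c ^ 3 * (y ^ 3 - 3 * y ^ 2 + y - 1) = 0"
      using char unfolding u c2 c3 ay by algebra
    hence y: "y ^ 3 - 3 * y ^ 2 + y - 1 = 0" using c0 by simp
    have c6: "c ^ 6 = 1" using t6 n(2) power_q_minus_1[of c] c0 assms(1)
      by (simp add: c_def n_def t_def)
    have a6: "a ^ 6 = y ^ 6" unfolding ay power_mult_distrib c6 by simp
    (* The multipliers are found by division by the cubic over the integers. *)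
    have y6: "y ^ 6 = 5 * y ^ 2 + 1"
    proof -
      have "y ^ 6 = 5 * y ^ 2 + 1 + (22 + 8 * y + 3 * y ^ 2 + y ^ 3) * (y ^ 3 - 3 * y ^ 2 + y - 1) + 7 * (3 - 2 * y + 8 * y ^ 2)"
        by algebra
      thus ?thesis unfolding y seven by simp
    qed
    have y12: "(5 * y ^ 2 + 1) ^ 2 = - y - 1"
    proof -
      have "(5 * y ^ 2 + 1) ^ 2 = - y - 1 + (75 + 25 * y) * (y ^ 3 - 3 * y ^ 2 + y - 1) + 7 * (11 - 7 * y + 30 * y ^ 2)"
        by algebra
      thus ?thesis unfolding y seven by simp
    qed
    have "a ^ 12 = (a ^ 6) ^ 2" "a ^ 24 = ((a ^ 6) ^ 2) ^ 2" by (simp_all flip: power_mult)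
    hence a: "a ^ 6 = 5 * y ^ 2 + 1" "a ^ 12 = - y - 1" "a ^ 24 = (- y - 1) ^ 2"
      unfolding a6 y6 y12 by simp_all
    have "2 * (- y - 1) ^ 2 + 4 * (- y - 1) + (5 * y ^ 2 + 1) + 1 = 7 * y ^ 2"
      by algebra
    thus ?thesis unfolding a seven by simp
  qed
qed

text \<open>With \<open>w = a ^ 6\<close> the other conjugates are \<open>w * a\<close> and
  \<open>w ^ 8 * a\<close>. The hypothesis is a quartic in \<open>w\<close> that splits modulo 7
  into a linear and a cubic factor, and the symmetric functions are computed modulo each.\<close>

lemma q_7_imp_conditions:
  assumes "q = 7" "a \<noteq> 0" and *: "2 * a ^ 24 + 4 * a ^ 12 + a ^ 6 + 1 = 0"
  shows "trace1 a * norm_K a = 3 * trace2 a ^ 2"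
    and "(norm_K a ^ 2 + 3 * trace2 a ^ 3) ^ 2 = 2"
proof -
  have seven: "(7::'a) = 0" using of_nat_q assms(1) by simp
  define w where "w = a ^ 6"
  have aq: "a ^ q = w * a" unfolding assms(1) w_def by algebra
  have "4 * (2 * a ^ 24 + 4 * a ^ 12 + a ^ 6 + 1) =
      (w - 4) * (w ^ 3 - 3 * w ^ 2 - 3 * w - 1) + 7 * (w ^ 4 + w ^ 3 + w ^ 2 - w)"
    unfolding w_def by algebra
  hence cases: "w - 4 = 0 \<or> w ^ 3 - 3 * w ^ 2 - 3 * w - 1 = 0"
    unfolding * seven by simp
  have "trace1 a * norm_K a = 3 * trace2 a ^ 2 \<and> (norm_K a ^ 2 + 3 * trace2 a ^ 3) ^ 2 = 2"
  proof (cases "w = 4")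
    \<comment> \<open>The conjugates are \<open>a\<close>, \<open>4 * a\<close> and
      \<open>2 * a\<close> modulo 7. As 1, 2, 4 are the cube roots of unity, \<open>trace1 a\<close>
      and \<open>trace2 a\<close> vanish.\<close>
    case True
    have "(w * a) ^ q = 16 * a"
      using closed_numeral[of "num.Bit0 (num.Bit0 num.One)"]
      unfolding power_mult_distrib aq True by (simp add: power_q)
    hence aqq: "a ^ (q ^ 2) = 16 * a" unfolding power_q_sq aq .
    have "trace1 a = 7 * (3 * a)" "trace2 a = 7 * (12 * a ^ 2)"
      unfolding trace1_def trace2_def aqq aq True by (simp_all add: power2_eq_square)
    hence 0: "trace1 a = 0" "trace2 a = 0" unfolding seven by simp_all
    have "norm_K a = a ^ 3 + 7 * (9 * a ^ 3)"
      unfolding norm_K_def aqq aq True by algebra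
    hence "norm_K a = a ^ 3" unfolding seven by simp
    hence "norm_K a ^ 2 = 4" using True by (simp add: w_def flip: power_mult)
    moreover have "(4::'a) ^ 2 = 2 + 7 * 2" by simp
    ultimately show ?thesis unfolding 0 seven by simp
  next
    case False
    hence E: "w ^ 3 - 3 * w ^ 2 - 3 * w - 1 = 0" using cases by simp
    (* The multipliers are again found by division by the cubic over the integers. *)
    have w7: "w ^ 7 = 2 * w ^ 2 + 3 * w + 2"
    proof -
      have "w ^ 7 = 2 * w ^ 2 + 3 * w + 2
          + (177 + 46 * w + 12 * w ^ 2 + 3 * w ^ 3 + w ^ 4) * (w ^ 3 - 3 * w ^ 2 - 3 * w - 1)
          + 7 * (25 + 82 * w + 97 * w ^ 2)"
        by algebra
      thus ?thesis unfolding E seven by simp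
    qed
    \<comment> \<open>Multiplying the previous remainder by \<open>w\<close> reduces
      \<open>w ^ 8\<close>, and then \<open>w ^ 9\<close>.\<close>
    have w8: "(2 * w ^ 2 + 3 * w + 2) * w = 2 * w ^ 2 + w + 2"
    proof -
      have "(2 * w ^ 2 + 3 * w + 2) * w
          = 2 * w ^ 2 + w + 2 + 2 * (w ^ 3 - 3 * w ^ 2 - 3 * w - 1) + 7 * (w + w ^ 2)"
        by algebra
      thus ?thesis unfolding E seven by simp
    qed
    have w9: "(2 * w ^ 2 + w + 2) * w = w + 2"
    proof -
      have "(2 * w ^ 2 + w + 2) * w
          = w + 2 + 2 * (w ^ 3 - 3 * w ^ 2 - 3 * w - 1) + 7 * (w + w ^ 2)"
        by algebra
      thus ?thesis unfolding E seven by simp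
    qed
    have "a ^ (q ^ 2) = w ^ 7 * (w * a)"
      unfolding power_q_sq aq power_mult_distrib by (simp add: assms(1))
    also have "\<dots> = (2 * w ^ 2 + w + 2) * a"
      unfolding w7 w8[symmetric] by algebra
    finally have aqq: "a ^ (q ^ 2) = (2 * w ^ 2 + w + 2) * a" .
    have u: "trace1 a = (2 * w ^ 2 + 2 * w + 3) * a"
      unfolding trace1_def aqq aq by algebra
    have "trace2 a = ((2 * w ^ 2 + w + 2) * w + (2 * w ^ 2 + w + 2) + w) * a ^ 2"
      unfolding trace2_def aqq aq by algebra
    also have "\<dots> = (2 * w ^ 2 + 3 * w + 4) * a ^ 2" unfolding w9 by algebra
    finally have t: "trace2 a = (2 * w ^ 2 + 3 * w + 4) * a ^ 2" .
    have "norm_K a = ((2 * w ^ 2 + w + 2) * w) * a ^ 3"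
      unfolding norm_K_def aqq aq by algebra
    hence n: "norm_K a = (w + 2) * a ^ 3" unfolding w9 .
    have "trace1 a * norm_K a = 3 * trace2 a ^ 2
        + a ^ 4 * ((- 70 - 12 * w) * (w ^ 3 - 3 * w ^ 2 - 3 * w - 1) + 7 * (- 16 - 41 * w - 45 * w ^ 2))"
      unfolding u t n by algebra
    hence P1: "trace1 a * norm_K a = 3 * trace2 a ^ 2" unfolding E seven by simp
    have "norm_K a ^ 2 = (w + 2) ^ 2 * w" unfolding n w_def by algebra
    also have "\<dots> = 1 + (w ^ 3 - 3 * w ^ 2 - 3 * w - 1) + 7 * (w + w ^ 2)" by algebra
    also have "\<dots> = 1" unfolding E seven by simp
    finally have n2: "norm_K a ^ 2 = 1" .
    have "trace2 a ^ 3 = (2 * w ^ 2 + 3 * w + 4) ^ 3 * w" unfolding t w_def by algebra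
    also have "\<dots> = 1 + (5013 + 1277 * w + 306 * w ^ 2 + 60 * w ^ 3 + 8 * w ^ 4) * (w ^ 3 - 3 * w ^ 2 - 3 * w - 1)
        + 7 * (716 + 2340 * w + 2760 * w ^ 2)" by algebra
    also have "\<dots> = 1" unfolding E seven by simp
    finally have t3: "trace2 a ^ 3 = 1" .
    have "(1 + 3 * 1) ^ 2 = (2 + 7 * 2 :: 'a)" by simp
    hence "(norm_K a ^ 2 + 3 * trace2 a ^ 3) ^ 2 = 2" unfolding n2 t3 seven by simp
    with P1 show ?thesis by simp
  qed
  thus "trace1 a * norm_K a = 3 * trace2 a ^ 2"
    and "(norm_K a ^ 2 + 3 * trace2 a ^ 3) ^ 2 = 2" by simp_all
qed

text \<open>Injectivity means \<open>A = 0\<close> and \<open>B ^ 2 = 2\<close> for the depressed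
  coefficients. The values 8 = 1, 1/2 = 4 and \<open>n ^ 6 = 1\<close> clear the
  denominators.\<close>

lemma inj_quartic_iff_q_7:
  assumes "q = 7" "a \<noteq> 0"
  shows "inj_on (quartic a) K \<longleftrightarrow> 2 * a ^ 24 + 4 * a ^ 12 + a ^ 6 + 1 = 0"
proof -
  define n t u where "n = norm_K a" and "t = trace2 a" and "u = trace1 a"
  have mem: "n \<in> K" "t \<in> K" "u \<in> K" and n: "n \<noteq> 0"
    using assms by (simp_all add: n_def t_def u_def)
  have n6: "n ^ 6 = 1" using power_q_minus_1[OF mem(1) n] assms(1) by simp
  have seven: "(7::'a) = 0" using of_nat_q assms(1) by simp
  have two: "(2::'a) \<noteq> 0" using even_iff assms(1) by simp
  have five: "(5::'a) \<noteq> 0"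
  proof
    assume "(5::'a) = 0"
    hence "(7 - 5 :: 'a) = 0" using seven by (simp only: diff_self)
    thus False using two by simp
  qed
  define A B where "A = u / n - 3 * t ^ 2 / (8 * n ^ 2)"
    and "B = 1 / n - t * u / (2 * n ^ 2) + t ^ 3 / (8 * n ^ 3)"
  have mAB: "A \<in> K" "B \<in> K" using mem by (simp_all add: A_def B_def)
  have "inj_on (quartic a) K \<longleftrightarrow> inj_on (\<lambda>x. x ^ 4 + A * x ^ 2 + B * x) K"
    using inj_quartic_depress[OF mem(1) n mem(2) two, of u] unfolding A_def B_def n_def t_def u_def .
  also have "\<dots> \<longleftrightarrow> A = 0 \<and> B ^ 2 = 2"
    using inj_quartic_3_mod_4[of A B] inj_quartic_7[of B] mAB two five assms(1) by auto
  also have "\<dots> \<longleftrightarrow> u * n = 3 * t ^ 2 \<and> (n ^ 2 + 3 * t ^ 3) ^ 2 = 2"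
  proof (rule conj_cong)
    have "(8::'a) = 1 + 7" "(4::'a) * 2 = 1 + 7" by simp_all
    hence eight: "(8::'a) = 1" and half: "(4::'a) * 2 = 1" unfolding seven by simp_all
    have "A = (u * n - 3 * t ^ 2) / n ^ 2"
      using n unfolding A_def eight by (simp add: field_simps power2_eq_square)
    thus A: "A = 0 \<longleftrightarrow> u * n = 3 * t ^ 2" using n by simp
    assume "u * n = 3 * t ^ 2"
    hence u: "u = 3 * t ^ 2 / n" using n by (simp add: field_simps)
    have h: "1 / 2 = (4::'a)" using half two by (simp add: field_simps)
    have "t * u / (2 * n ^ 2) = (1 / 2) * (t * u / n ^ 2)" by simp
    also have "\<dots> = 12 * t ^ 3 / n ^ 3" unfolding h u using n
      by (simp add: power2_eq_square power3_eq_cube mult_ac)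
    finally have "B = 1 / n - 12 * t ^ 3 / n ^ 3 + t ^ 3 / n ^ 3"
      unfolding B_def eight by simp
    also have "\<dots> = (n ^ 2 + 3 * t ^ 3 - 7 * (2 * t ^ 3)) / n ^ 3"
      using n by (simp add: field_simps power2_eq_square power3_eq_cube)
    finally have "B = (n ^ 2 + 3 * t ^ 3) / n ^ 3" unfolding seven by simp
    hence "B ^ 2 = (n ^ 2 + 3 * t ^ 3) ^ 2"
      by (simp add: power_divide n6 flip: power_mult)
    thus "B ^ 2 = 2 \<longleftrightarrow> (n ^ 2 + 3 * t ^ 3) ^ 2 = 2" by simp
  qed
  also have "\<dots> \<longleftrightarrow> 2 * a ^ 24 + 4 * a ^ 12 + a ^ 6 + 1 = 0"
    unfolding n_def t_def u_def
    using q_7_conditions_imp[OF assms] q_7_imp_conditions[OF assms] by blast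
  finally show ?thesis .
qed

lemma not_inj_quartic_odd:
  assumes "odd q" "q \<noteq> 3" "q \<noteq> 7" "a \<noteq> 0"
  shows "\<not> inj_on (quartic a) K"
proof
  assume inj: "inj_on (quartic a) K"
  have two: "(2::'a) \<noteq> 0" using even_iff assms(1) by simp
  have nz: "norm_K a \<noteq> 0" using assms(4) by simp
  define n t u where "n = norm_K a" and "t = trace2 a" and "u = trace1 a"
  define A B where "A = u / n - 3 * t ^ 2 / (8 * n ^ 2)"
    and "B = 1 / n - t * u / (2 * n ^ 2) + t ^ 3 / (8 * n ^ 3)"
  have AB: "A \<in> K" "B \<in> K" "inj_on (\<lambda>x. x ^ 4 + A * x ^ 2 + B * x) K"
    using inj inj_quartic_depress[OF norm_K_mem nz trace2_mem two, of a "trace1 a"]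
    unfolding A_def B_def n_def t_def u_def by simp_all
  have "q mod 4 \<noteq> 1"
    using not_inj_quartic_1_mod_4[of A B 0] AB by auto
  hence q3: "q mod 4 = 3" using assms(1) by presburger
  \<comment> \<open>Every power of 5 is 1 modulo 4.\<close>
  have five: "(5::'a) \<noteq> 0"
  proof
    assume "(5::'a) = 0"
    then obtain m where "q = 5 ^ m"
      using numeral_eq_0_imp_q_power[of "num.Bit1 (num.Bit0 num.One)"] by auto
    hence "q mod 4 = 1" by (simp add: power_mod[symmetric, of 5])
    thus False using q3 by simp
  qed
  have "q \<ge> 7" using q3 assms(2) by presburger
  from inj_quartic_3_mod_4[OF AB(3) q3 this AB(1,2) two five] show False
    using assms(3) by simp
qed

end

theorem corollary3p5:
  fixes Q :: nat
    and FQ :: "'a::{field,finite} set"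
    and \<alpha> \<beta> :: 'a
    and f :: "'a poly"
  assumes "primepow Q"
    and "CARD('a) = Q ^ 3"
    and "is_subfield FQ"
    and "card FQ = Q"
    and "\<alpha> \<noteq> 0"
    and "\<beta> \<in> FQ"
  defines "f \<equiv> monom \<alpha> (Q^2 + Q + 2) + monom \<beta> 1"
  shows "complete_permutation_polynomial f \<longleftrightarrow>
      (even Q \<and> \<alpha> ^ (Q^2) + \<alpha> ^ (Q^2 - Q + 1) + \<alpha> = 0)
    \<or> (Q = 7 \<and> 2 * \<alpha> ^ 24 + 4 * \<alpha> ^ 12 + \<alpha> ^ 6 + 1 = 0 \<and> \<beta> \<notin> {0, -1})
    \<or> (Q = 3 \<and> \<alpha> ^ 12 + \<alpha> ^ 8 + \<alpha> ^ 2 + 1 = 0 \<and> \<beta> = 1)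
    \<or> (Q = 2 \<and> \<alpha> \<noteq> 1)"
proof -
  interpret cubic_extension FQ
    by standard (use assms in auto)
  note Q = \<open>card FQ = Q\<close>
  have complete: "complete_permutation_polynomial f \<longleftrightarrow>
      inj_on (quartic \<alpha>) FQ \<and> (even Q \<or> \<beta> \<notin> {0, - 1})"
    using complete_iff[OF \<open>\<alpha> \<noteq> 0\<close> \<open>\<beta> \<in> FQ\<close>] unfolding f_def Q .
  have tr: "trace2 \<alpha> = 0 \<longleftrightarrow> \<alpha> ^ (Q^2) + \<alpha> ^ (Q^2 - Q + 1) + \<alpha> = 0"
    using trace2_eq_0_iff[OF \<open>\<alpha> \<noteq> 0\<close>] unfolding Q .
  have Q2: "Q \<ge> 2" using q_ge_2 Q by simp
  consider "Q = 2" | "even Q" "Q > 2" | "Q = 3" | "Q = 7" | "odd Q" "Q \<noteq> 3" "Q \<noteq> 7"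
    using Q2 by linarith
  thus ?thesis
  proof cases
    case 1
    \<comment> \<open>For \<open>Q = 2\<close> the first alternative implies the fourth.\<close>
    have "trace2 1 = 3"
      by (simp add: trace2_def)
    moreover have "(3::'a) \<noteq> 0"
    proof
      assume "(3::'a) = 0"
      moreover have "(2::'a) = 0" using even_iff Q 1 by simp
      ultimately have "(3 - 2 :: 'a) = 0" by (simp only: diff_self)
      thus False by simp
    qed
    ultimately have "trace2 \<alpha> = 0 \<longrightarrow> \<alpha> \<noteq> 1" by auto
    thus ?thesis
      using complete inj_quartic_iff_q_2[of \<alpha>] tr Q 1 by auto
  next
    case 2
    thus ?thesis
      using complete inj_quartic_iff_even[of \<alpha>] tr Q \<open>\<alpha> \<noteq> 0\<close> by auto
  next
    case 3
    \<comment> \<open>Here \<open>FQ\<close> is \<open>{0, 1, - 1}\<close>, so excluding 0 and -1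
      leaves \<open>\<beta> = 1\<close>.\<close>
    have "(1::'a) \<noteq> - 1"
    proof
      assume "(1::'a) = - 1"
      hence "(1::'a) + 1 = 0" by (simp only: eq_neg_iff_add_eq_0)
      thus False using even_iff Q 3 by simp
    qed
    hence "card {0, 1, - 1 :: 'a} = 3" by auto
    hence "{0, 1, - 1} = FQ"
      using Q 3 by (intro card_subset_eq[OF finite_K]) auto
    hence "\<beta> \<notin> {0, - 1} \<longleftrightarrow> \<beta> = 1"
      using \<open>\<beta> \<in> FQ\<close> \<open>1 \<noteq> - 1\<close> by auto
    thus ?thesis
      using complete inj_quartic_iff_q_3[of \<alpha>] Q 3 \<open>\<alpha> \<noteq> 0\<close> by auto
  next
    case 4
    thus ?thesis
      using complete inj_quartic_iff_q_7[of \<alpha>] Q \<open>\<alpha> \<noteq> 0\<close> by auto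
  next
    case 5
    thus ?thesis
      using complete not_inj_quartic_odd[of \<alpha>] Q \<open>\<alpha> \<noteq> 0\<close> by auto
  qed
qed

end
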